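(* Let $s\ge1$ be an integer and let $X_1,X_2,\ldots$ be i.i.d. exponential random variables (the null hypothesis $H_0$). As $n\to\infty$, $\sqrt n\,\widehat\Delta^*$, where $\widehat\Delta^*=\widehat\Delta/\bar X$, converges in distribution to a Gaussian random variable with mean zero and variance $$\sigma_0^2=\frac{s}{4s^2-1}.$$
   Context: $\bar X=\frac1n\sum_{i=1}^nX_i$ is the sample mean. Define the symmetric kernel $$h(x_1,\ldots,x_{s+1})=(s+1)\min(x_1,\ldots,x_{s+1})-\frac{1}{s+1}\sum_{1\le i_1<\cdots<i_s\le s+1}s\min(x_{i_1},\ldots,x_{i_s}),$$ and for $n\ge s+1$ the U-statistic $$\widehat\Delta=\binom{n}{s+1}^{-1}\sum_{1\le i_1<\cdots<i_{s+1}\le n}h(X_{i_1},\ldots,X_{i_{s+1}}).$$ *)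

theory Defs
  imports "HOL-Probability.Probability"
begin

text \<open>
  Samples and kernel arguments are functions on \<^typ>\<open>nat\<close>, indexed from \<open>0\<close>: the observations
  \<open>X\<^sub>1, \<dots>, X\<^sub>n\<close> are \<open>x 0, \<dots>, x (n - 1)\<close>.
  Index tuples \<open>i\<^sub>1 < \<dots> < i\<^sub>k\<close> are strictly increasing functions from \<open>{..<k}\<close> to \<open>{..<n}\<close>;
  the extensional function space makes each of them a single element of the sum.
\<close>

definition incr_tuples :: "nat \<Rightarrow> nat \<Rightarrow> (nat \<Rightarrow> nat) set" where
  "incr_tuples k n = {i \<in> {..<k} \<rightarrow>\<^sub>E {..<n}. strict_mono_on {..<k} i}"

definition kernel :: "nat \<Rightarrow> (nat \<Rightarrow> real) \<Rightarrow> real" where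
  "kernel s x =
     (real s + 1) * Min (x ` {..<s + 1})
     - 1 / (real s + 1) * (\<Sum>i\<in>incr_tuples s (s + 1). real s * Min ((\<lambda>j. x (i j)) ` {..<s}))"

definition U_statistic :: "nat \<Rightarrow> ((nat \<Rightarrow> real) \<Rightarrow> real) \<Rightarrow> nat \<Rightarrow> (nat \<Rightarrow> real) \<Rightarrow> real" where
  "U_statistic m h n x =
     inverse (real (n choose m)) * (\<Sum>i\<in>incr_tuples m n. h (\<lambda>j. x (i j)))"

definition Delta_hat :: "nat \<Rightarrow> nat \<Rightarrow> (nat \<Rightarrow> real) \<Rightarrow> real" where
  "Delta_hat s n x = U_statistic (s + 1) (kernel s) n x"

definition sample_mean :: "nat \<Rightarrow> (nat \<Rightarrow> real) \<Rightarrow> real" where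
  "sample_mean n x = (\<Sum>i<n. x i) / real n"

definition Delta_hat_star :: "nat \<Rightarrow> nat \<Rightarrow> (nat \<Rightarrow> real) \<Rightarrow> real" where
  "Delta_hat_star s n x = Delta_hat s n x / sample_mean n x"

end

theory Submission
  imports Defs "HOL-Real_Asymp.Real_Asymp"
begin

text \<open>
  The minimum of finitely many nonnegative numbers is an integral over levels:
  \<open>Min (x ` S)\<close> is the integral over \<open>t \<ge> 0\<close> of the indicator that every \<open>x i\<close> with \<open>i \<in> S\<close>
  is at least \<open>t\<close>. Summing over all \<open>k\<close>-subsets of the sample, with \<open>N t\<close> the number of
  observations that are at least \<open>t\<close>, gives the integral of \<open>N t choose k\<close>. So the average
  \<open>mean_min k\<close> of the minima over \<open>k\<close>-subsets is, up to an error of order \<open>1 / n\<close>, the integral of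
  \<open>(N t / n) ^ k\<close>, a smooth functional of the empirical survival function. On the other hand,
  counting incidences between \<open>s\<close>-subsets and \<open>(s + 1)\<close>-subsets shows that the U-statistic is
  \<open>(s + 1) * mean_min (s + 1) - s * mean_min s\<close> (lemma \<open>Delta_hat_eq_mean_min\<close>).

  Expanding \<open>(N t / n) ^ k\<close> to first order around the true survival function \<open>exp (- l t)\<close>
  leaves a quadratic remainder controlled by the integral of \<open>(N t / n - exp (- l t))\<^sup>2\<close>, whose
  expectation is \<open>1 / (2 l n)\<close>. The constant terms of the two values of \<open>k\<close> cancel under the
  exponential law, and the linear terms form the sample mean of the i.i.d. variables
  \<open>influence l s (X i)\<close> (lemma \<open>Delta_hat_approx\<close>). These are centred with variance
  \<open>s / (4 s\<^sup>2 - 1) / l\<^sup>2\<close> (lemma \<open>influence_moments\<close>), so the central limit theorem applies to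
  them, while the remainder is negligible in mean even after multiplication by \<open>sqrt n\<close>.

  The denominator is the sample mean, which tends to \<open>1 / l\<close>; dividing by it multiplies the limit
  by \<open>l\<close> and removes \<open>l\<^sup>2\<close> from the variance. Both perturbations, the remainder and the random
  denominator, are absorbed at once by a comparison principle proved with characteristic functions
  (lemma \<open>weak_conv_m_of_close\<close>): if \<open>min 1 \<bar>A n - B n\<bar>\<close> is bounded by variables whose expectations
  tend to \<open>0\<close>, then \<open>A n\<close> and \<open>B n\<close> have the same limit law.
\<close>

section \<open>The U-statistic as a combination of average minima\<close>

definition k_subsets :: "nat \<Rightarrow> nat \<Rightarrow> nat set set" where
  "k_subsets k n = {S. S \<subseteq> {..<n} \<and> card S = k}"

lemma Suc_times_binomial_Suc:
  assumes "k \<le> n"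
  shows "(real k + 1) * real (n choose Suc k) = (real n - real k) * real (n choose k)"
proof -
  have "Suc k * (n choose Suc k) = (n - k) * (n choose k)"
    by (simp only: binomial_absorption binomial_absorb_comp)
  then have "real (Suc k) * real (n choose Suc k) = real (n - k) * real (n choose k)"
    by (simp only: of_nat_mult[symmetric])
  then show ?thesis
    using assms by (simp add: of_nat_diff algebra_simps)
qed

lemma finite_k_subsets: "finite (k_subsets k n)"
  by (rule finite_subset[of _ "Pow {..<n}"]) (auto simp: k_subsets_def)

lemma k_subsetsD:
  assumes "S \<in> k_subsets k n"
  shows "S \<subseteq> {..<n}" "card S = k" "finite S"
  using assms finite_subset[of S "{..<n}"] by (auto simp: k_subsets_def)

lemma incr_tupleD:
  assumes "i \<in> incr_tuples k n"
  shows "i ` {..<k} \<in> k_subsets k n" "inj_on i {..<k}"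
proof -
  have sm: "strict_mono_on {..<k} i" and im: "i ` {..<k} \<subseteq> {..<n}"
    using assms by (auto simp: incr_tuples_def PiE_def Pi_def)
  show inj: "inj_on i {..<k}"
    using sm by (rule strict_mono_on_imp_inj_on)
  show "i ` {..<k} \<in> k_subsets k n"
    using im inj by (simp add: k_subsets_def card_image)
qed

text \<open>
  A strictly increasing tuple is the sorted list of its values, hence determined by its image.
\<close>

lemma bij_betw_incr_tuples:
  "bij_betw (\<lambda>i. i ` {..<k}) (incr_tuples k n) (k_subsets k n)"
proof (rule bij_betw_imageI)
  show "inj_on (\<lambda>i. i ` {..<k}) (incr_tuples k n)"
  proof (rule inj_onI)
    fix i j assume i: "i \<in> incr_tuples k n" and j: "j \<in> incr_tuples k n"
      and eq: "i ` {..<k} = j ` {..<k}"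
    have sorted: "map i [0..<k] = sorted_list_of_set (i ` {..<k})"
      if "i \<in> incr_tuples k n" for i
    proof -
      have sm: "strict_mono_on {..<k} i"
        using that by (simp add: incr_tuples_def)
      have "sorted_wrt (<) (map i [0..<k])"
        unfolding sorted_wrt_iff_nth_less using sm by (auto simp: strict_mono_on_def)
      then show ?thesis
        using sorted_list_of_set.idem_if_sorted_distinct[of "map i [0..<k]"]
        by (simp add: strict_sorted_iff atLeast0LessThan)
    qed
    have "map i [0..<k] = map j [0..<k]"
      using sorted[OF i] sorted[OF j] eq by simp
    then have *: "i m = j m" if "m < k" for m
      using that by (auto simp: list_eq_iff_nth_eq)
    show "i = j"
    proof (rule PiE_ext)
      show "i \<in> {..<k} \<rightarrow>\<^sub>E {..<n}" "j \<in> {..<k} \<rightarrow>\<^sub>E {..<n}"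
        using i j by (auto simp: incr_tuples_def)
    qed (use * in auto)
  qed
  show "(\<lambda>i. i ` {..<k}) ` incr_tuples k n = k_subsets k n"
  proof (intro subset_antisym subsetI)
    fix S assume S: "S \<in> k_subsets k n"
    obtain h where h: "bij_betw h {..<card S} S" "strict_mono_on {..<card S} h"
      using ex_bij_betw_strict_mono_card[OF k_subsetsD(3)[OF S]] by blast
    define i where "i = restrict h {..<k}"
    have img: "h ` {..<k} = S" and sm: "strict_mono_on {..<k} h"
      using h k_subsetsD(2)[OF S] by (auto simp: bij_betw_def atLeast0LessThan)
    have "i \<in> incr_tuples k n"
      using img sm k_subsetsD(1)[OF S]
      by (auto simp: i_def incr_tuples_def strict_mono_on_def)
    moreover have "i ` {..<k} = S"
      using img by (simp add: i_def)
    ultimately show "S \<in> (\<lambda>i. i ` {..<k}) ` incr_tuples k n"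
      by blast
  qed (auto simp: incr_tupleD)
qed

lemma sum_incr_tuples: "(\<Sum>i\<in>incr_tuples k n. F (i ` {..<k})) = (\<Sum>S\<in>k_subsets k n. F S)"
  by (rule sum.reindex_bij_betw[OF bij_betw_incr_tuples])

text \<open>
  Double counting: an \<open>s\<close>-subset of \<open>n\<close> points extends to an \<open>(s + 1)\<close>-subset in \<open>n - s\<close> ways.
\<close>

lemma sum_over_nested_k_subsets:
  fixes F :: "nat set \<Rightarrow> real"
  assumes "s \<le> n"
  shows "(\<Sum>S\<in>k_subsets (Suc s) n. \<Sum>T\<in>{T. T \<subseteq> S \<and> card T = s}. F T)
    = real (n - s) * (\<Sum>T\<in>k_subsets s n. F T)"
proof -
  have "(\<Sum>S\<in>k_subsets (Suc s) n. \<Sum>T\<in>{T. T \<subseteq> S \<and> card T = s}. F T)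
    = (\<Sum>S\<in>k_subsets (Suc s) n. \<Sum>T\<in>{T\<in>k_subsets s n. T \<subseteq> S}. F T)"
    by (intro sum.cong) (auto simp: k_subsets_def)
  also have "\<dots> = (\<Sum>T\<in>k_subsets s n. \<Sum>S\<in>{S\<in>k_subsets (Suc s) n. T \<subseteq> S}. F T)"
    by (rule sum.swap_restrict) (auto simp: finite_k_subsets)
  also have "\<dots> = (\<Sum>T\<in>k_subsets s n. real (n - s) * F T)"
  proof (rule sum.cong[OF refl])
    fix T assume T: "T \<in> k_subsets s n"
    have "{S\<in>k_subsets (Suc s) n. T \<subseteq> S} = (\<lambda>x. insert x T) ` ({..<n} - T)"
    proof (intro subset_antisym subsetI)
      fix S assume "S \<in> {S\<in>k_subsets (Suc s) n. T \<subseteq> S}"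
      then have S: "S \<in> k_subsets (Suc s) n" "T \<subseteq> S" by auto
      have "card (S - T) = 1"
        using S k_subsetsD[OF T] k_subsetsD[OF S(1)] by (simp add: card_Diff_subset)
      then obtain x where "S - T = {x}"
        by (rule card_1_singletonE)
      then have "S = insert x T" "x \<in> {..<n} - T"
        using S k_subsetsD(1)[OF S(1)] by auto
      then show "S \<in> (\<lambda>x. insert x T) ` ({..<n} - T)"
        by blast
    qed (use k_subsetsD[OF T] in \<open>auto simp: k_subsets_def\<close>)
    moreover have "inj_on (\<lambda>x. insert x T) ({..<n} - T)"
      by (auto simp: inj_on_def)
    moreover have "card ({..<n} - T) = n - s"
      using k_subsetsD[OF T] by (simp add: card_Diff_subset)
    ultimately have "card {S\<in>k_subsets (Suc s) n. T \<subseteq> S} = n - s"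
      by (simp add: card_image)
    then show "(\<Sum>S\<in>{S\<in>k_subsets (Suc s) n. T \<subseteq> S}. F T) = real (n - s) * F T"
      by simp
  qed
  finally show ?thesis
    by (simp add: sum_distrib_left)
qed

definition mean_min :: "nat \<Rightarrow> nat \<Rightarrow> (nat \<Rightarrow> real) \<Rightarrow> real" where
  "mean_min k n x = (\<Sum>S\<in>k_subsets k n. Min (x ` S)) / real (n choose k)"

text \<open>
  The inner sum of the kernel runs over index tuples of positions; composed with an outer tuple
  these become the \<open>s\<close>-subsets of the outer index set.
\<close>

lemma kernel_incr_tuple:
  assumes i: "i \<in> incr_tuples (s + 1) n"
  shows "kernel s (\<lambda>j. x (i j)) =
    (real s + 1) * Min (x ` i ` {..<s + 1})
    - real s / (real s + 1) * (\<Sum>T\<in>{T. T \<subseteq> i ` {..<s + 1} \<and> card T = s}. Min (x ` T))"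
proof -
  have inj: "inj_on i {..<s + 1}"
    using incr_tupleD[OF i] by simp
  have "(\<Sum>i'\<in>incr_tuples s (s + 1). real s * Min ((\<lambda>j. x (i (i' j))) ` {..<s}))
    = real s * (\<Sum>i'\<in>incr_tuples s (s + 1). Min (x ` i ` (i' ` {..<s})))"
    by (simp add: image_image sum_distrib_left)
  also have "(\<Sum>i'\<in>incr_tuples s (s + 1). Min (x ` i ` (i' ` {..<s})))
    = (\<Sum>S\<in>k_subsets s (s + 1). Min (x ` i ` S))"
    by (rule sum_incr_tuples)
  also have "\<dots> = (\<Sum>T\<in>{T. T \<subseteq> i ` {..<s + 1} \<and> card T = s}. Min (x ` T))"
  proof (rule sum.reindex_bij_betw)
    show "bij_betw ((`) i) (k_subsets s (s + 1)) {T. T \<subseteq> i ` {..<s + 1} \<and> card T = s}"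
    proof (rule bij_betw_imageI)
      show "inj_on ((`) i) (k_subsets s (s + 1))"
        using inj_on_image_Pow[OF inj] by (rule inj_on_subset) (auto simp: k_subsets_def)
      show "(`) i ` k_subsets s (s + 1) = {T. T \<subseteq> i ` {..<s + 1} \<and> card T = s}"
      proof (intro subset_antisym subsetI)
        fix T assume "T \<in> {T. T \<subseteq> i ` {..<s + 1} \<and> card T = s}"
        then obtain S where S: "S \<subseteq> {..<s + 1}" "T = i ` S" and "card T = s"
          by (auto simp: subset_image_iff)
        then have "card S = s"
          using card_image[OF inj_on_subset[OF inj S(1)]] by simp
        then show "T \<in> (`) i ` k_subsets s (s + 1)"
          using S by (auto simp: k_subsets_def)
      next
        fix T assume "T \<in> (`) i ` k_subsets s (s + 1)"
        then obtain S where S: "S \<subseteq> {..<s + 1}" "card S = s" "T = i ` S"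
          by (auto simp: k_subsets_def)
        then show "T \<in> {T. T \<subseteq> i ` {..<s + 1} \<and> card T = s}"
          using card_image[OF inj_on_subset[OF inj S(1)]] by auto
      qed
    qed
  qed
  finally show ?thesis
    by (simp add: kernel_def image_image)
qed

text \<open>
  The weights fit together because \<open>(s + 1) * (n choose (s + 1)) = (n - s) * (n choose s)\<close>.
\<close>

lemma Delta_hat_eq_mean_min:
  assumes "s + 1 \<le> n"
  shows "Delta_hat s n x = (real s + 1) * mean_min (s + 1) n x - real s * mean_min s n x"
proof -
  define A where "A = (\<Sum>S\<in>k_subsets (Suc s) n. Min (x ` S))"
  define B where "B = (\<Sum>T\<in>k_subsets s n. Min (x ` T))"
  have "(\<Sum>i\<in>incr_tuples (s + 1) n. kernel s (\<lambda>j. x (i j)))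
    = (\<Sum>i\<in>incr_tuples (s + 1) n. (real s + 1) * Min (x ` i ` {..<s + 1})
    - real s / (real s + 1) * (\<Sum>T\<in>{T. T \<subseteq> i ` {..<s + 1} \<and> card T = s}. Min (x ` T)))"
    by (intro sum.cong refl kernel_incr_tuple)
  also have "\<dots> = (\<Sum>S\<in>k_subsets (s + 1) n. (real s + 1) * Min (x ` S)
    - real s / (real s + 1) * (\<Sum>T\<in>{T. T \<subseteq> S \<and> card T = s}. Min (x ` T)))"
    by (rule sum_incr_tuples)
  also have "\<dots> = (real s + 1) * A - real s / (real s + 1) * (real (n - s) * B)"
    unfolding sum_subtractf sum_distrib_left[symmetric] A_def B_def
    using sum_over_nested_k_subsets[of s n "\<lambda>T. Min (x ` T)"] assms by simp
  finally have sum_eq: "(\<Sum>i\<in>incr_tuples (s + 1) n. kernel s (\<lambda>j. x (i j)))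
    = (real s + 1) * A - real s / (real s + 1) * (real (n - s) * B)" .
  have ch: "(real s + 1) * real (n choose Suc s) = real (n - s) * real (n choose s)"
    using Suc_times_binomial_Suc[of s n] assms by (simp add: of_nat_diff)
  have pos: "real (n choose Suc s) > 0" "real (n choose s) > 0" "real (n - s) > 0"
    using assms by auto
  have s0: "real s + 1 \<noteq> 0" by linarith
  have ratio: "real (n - s) / ((real s + 1) * real (n choose Suc s)) = 1 / real (n choose s)"
    unfolding ch using pos by simp
  have "Delta_hat s n x = (real s + 1) * A / real (n choose Suc s)
    - real s * B * (real (n - s) / ((real s + 1) * real (n choose Suc s)))"
    unfolding Delta_hat_def U_statistic_def sum_eq
    by (simp add: divide_inverse right_diff_distrib inverse_mult_distrib mult_ac)
  then show ?thesis
    unfolding ratio by (simp add: mean_min_def A_def B_def)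
qed

section \<open>Sampling without replacement and linearization of powers\<close>
text \<open>
  First-order Taylor expansion of \<open>p ^ k\<close> at \<open>q\<close>; the induction multiplies the remainder by \<open>p\<close>
  and adds \<open>k * q ^ (k - 1) * (p - q)\<^sup>2\<close>.
\<close>

lemma power_linearization:
  fixes p q :: real
  assumes "0 \<le> p" "p \<le> 1" "0 \<le> q" "q \<le> 1"
  shows "\<bar>p ^ k - q ^ k - real k * q ^ (k - 1) * (p - q)\<bar> \<le> (real k)\<^sup>2 * (p - q)\<^sup>2"
proof (induction k)
  case (Suc k)
  have split: "p ^ Suc k - q ^ Suc k - real (Suc k) * q ^ (Suc k - 1) * (p - q)
    = p * (p ^ k - q ^ k - real k * q ^ (k - 1) * (p - q)) + real k * q ^ (k - 1) * (p - q)\<^sup>2"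
    by (cases k) (simp_all add: algebra_simps power2_eq_square)
  have "\<bar>p * (p ^ k - q ^ k - real k * q ^ (k - 1) * (p - q))\<bar>
    \<le> 1 * ((real k)\<^sup>2 * (p - q)\<^sup>2)"
    unfolding abs_mult using assms by (intro mult_mono Suc) auto
  moreover have "\<bar>real k * q ^ (k - 1) * (p - q)\<^sup>2\<bar> \<le> real k * 1 * (p - q)\<^sup>2"
    unfolding abs_mult using assms
    by (intro mult_mono) (auto intro: power_le_one)
  ultimately have "\<bar>p ^ Suc k - q ^ Suc k - real (Suc k) * q ^ (Suc k - 1) * (p - q)\<bar>
    \<le> (real k)\<^sup>2 * (p - q)\<^sup>2 + real k * (p - q)\<^sup>2"
    unfolding split by linarith
  also have "\<dots> = ((real k)\<^sup>2 + real k) * (p - q)\<^sup>2"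
    by (simp add: algebra_simps)
  also have "\<dots> \<le> (real (Suc k))\<^sup>2 * (p - q)\<^sup>2"
    by (intro mult_right_mono) (simp_all, simp add: power2_eq_square algebra_simps)
  finally show ?case .
qed simp

lemma binomial_Suc_ratio:
  assumes "k < n"
  shows "real (N choose Suc k) / real (n choose Suc k)
    = real (N choose k) / real (n choose k) * ((real N - real k) / (real n - real k))"
proof (cases "N < k")
  case True
  then show ?thesis by (simp add: binomial_eq_0)
next
  case False
  have "real k + 1 \<noteq> 0" by linarith
  then have "real (N choose Suc k) / real (n choose Suc k)
    = ((real k + 1) * real (N choose Suc k)) / ((real k + 1) * real (n choose Suc k))"
    by simp
  also have "\<dots> = ((real N - real k) * real (N choose k)) / ((real n - real k) * real (n choose k))"
    using Suc_times_binomial_Suc[of k N] Suc_times_binomial_Suc[of k n] False assms by simp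
  finally show ?thesis
    by (simp add: mult.commute)
qed

lemma binomial_ratio_le:
  assumes "N \<le> n" "1 \<le> k" "k \<le> n"
  shows "real (N choose k) / real (n choose k) \<le> real N / real n"
  using assms(2,3)
proof (induction k rule: dec_induct)
  case base
  then show ?case by simp
next
  case (step k)
  have "(real N - real k) / (real n - real k) \<le> 1"
    using step.prems assms(1) by simp
  then have "real (N choose Suc k) / real (n choose Suc k) \<le> real (N choose k) / real (n choose k)"
    unfolding binomial_Suc_ratio[OF Suc_le_lessD[OF step.prems]]
    by (intro mult_left_le) auto
  then show ?case
    using step by simp
qed

text \<open>
  The ratio of binomial coefficients is the probability that \<open>k\<close> draws without replacement all hit a
  set of \<open>N\<close> out of \<open>n\<close> points; with replacement it is \<open>(N / n) ^ k\<close>. The factor \<open>N / n\<close> in the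
  bound matters: integrated over levels it yields the sample mean, whereas a constant bound
  would not be integrable over the half-line.
\<close>

lemma binomial_ratio_approx:
  assumes "N \<le> n" "1 \<le> k" "k < n"
  shows "\<bar>real (N choose k) / real (n choose k) - (real N / real n) ^ k\<bar>
    \<le> (real k)\<^sup>2 / (real n - real k) * (real N / real n)"
  using assms(2,3)
proof (induction k rule: dec_induct)
  case base
  then show ?case using assms by simp
next
  case (step k)
  define p where "p = real N / real n"
  define r where "r = real (N choose k) / real (n choose k)"
  have kn: "k < n" "real n - real k > 0" "real n - real (Suc k) > 0"
    using step.prems by auto
  have p: "0 \<le> p" "p \<le> 1"
    using assms kn by (auto simp: p_def)
  have r: "0 \<le> r" "r \<le> p"
    using binomial_ratio_le[OF assms(1) step.hyps(1)] kn by (auto simp: r_def p_def)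
  have "\<bar>r * ((real N - real k) / (real n - real k) - p)\<bar> \<le> p * (real k / (real n - real k))"
  proof (cases "N < k")
    case True
    then have "r = 0" by (simp add: r_def binomial_eq_0)
    then show ?thesis using p kn by simp
  next
    case False
    have "(real N - real k) / (real n - real k) - p
      = - ((real k / (real n - real k)) * ((real n - real N) / real n))"
      using kn by (simp add: p_def field_simps)
    then have "\<bar>(real N - real k) / (real n - real k) - p\<bar>
      = (real k / (real n - real k)) * ((real n - real N) / real n)"
      using assms kn by simp
    also have "\<dots> \<le> real k / (real n - real k) * 1"
      using assms kn by (intro mult_left_mono) auto
    finally have "\<bar>(real N - real k) / (real n - real k) - p\<bar> \<le> real k / (real n - real k)"
      by simp
    then show ?thesis
      unfolding abs_mult using r p by (intro mult_mono) auto
  qed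
  moreover have "\<bar>(r - p ^ k) * p\<bar> \<le> (real k)\<^sup>2 / (real n - real k) * p * 1"
    unfolding abs_mult using step.IH kn p
    by (intro mult_mono) (auto simp: r_def p_def)
  moreover have "real (N choose Suc k) / real (n choose Suc k) - p ^ Suc k
    = (r - p ^ k) * p + r * ((real N - real k) / (real n - real k) - p)"
    unfolding binomial_Suc_ratio[OF kn(1)] r_def[symmetric] by (simp add: algebra_simps)
  ultimately have "\<bar>real (N choose Suc k) / real (n choose Suc k) - p ^ Suc k\<bar>
    \<le> ((real k)\<^sup>2 + real k) / (real n - real k) * p"
    by (simp add: add_divide_distrib algebra_simps)
  also have "\<dots> \<le> (real (Suc k))\<^sup>2 / (real n - real (Suc k)) * p"
    using kn p by (intro mult_right_mono frac_le) (auto simp: power2_eq_square algebra_simps)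
  finally show ?case
    by (simp add: p_def)
qed

section \<open>Average minima as integrals over levels\<close>

text \<open>
  The integral of \<open>exp (- a t)\<close> over \<open>t\<close> between \<open>0\<close> and \<open>x\<close>. Rate \<open>0\<close> is included because for
  \<open>s = 1\<close> the second term of the influence function is linear in \<open>x\<close>.
\<close>
definition exp_primitive :: "real \<Rightarrow> real \<Rightarrow> real" where
  "exp_primitive a x = (if a = 0 then x else (1 - exp (- (a * x))) / a)"

lemma exp_primitive_0 [simp]: "exp_primitive a 0 = 0"
  by (simp add: exp_primitive_def)

lemma exp_primitive_zero_rate [simp]: "exp_primitive 0 x = x"
  by (simp add: exp_primitive_def)

lemma DERIV_exp_primitive [derivative_intros]:
  "(exp_primitive a has_real_derivative exp (- (a * x))) (at x)"
proof (cases "a = 0")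
  case True
  then have "exp_primitive a = (\<lambda>x. x)"
    by (simp add: exp_primitive_def fun_eq_iff)
  then show ?thesis using True by simp
next
  case False
  then have "exp_primitive a = (\<lambda>x. (1 - exp (- (a * x))) / a)"
    by (simp add: exp_primitive_def fun_eq_iff)
  then show ?thesis
    using False by (auto intro!: derivative_eq_intros)
qed

lemma borel_measurable_exp_primitive [measurable]: "exp_primitive a \<in> borel_measurable borel"
  unfolding exp_primitive_def[abs_def] by measurable

lemma exp_primitive_bounds:
  assumes "0 \<le> a" "0 \<le> x"
  shows "0 \<le> exp_primitive a x" "exp_primitive a x \<le> x"
proof -
  have "a \<noteq> 0 \<Longrightarrow> 0 < a"
    using assms by simp
  moreover have "exp (- (a * x)) \<le> 1"
    using assms by simp
  moreover have "1 - a * x \<le> exp (- (a * x))"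
    using exp_ge_add_one_self[of "- (a * x)"] by simp
  ultimately show "0 \<le> exp_primitive a x" "exp_primitive a x \<le> x"
    using assms by (auto simp: exp_primitive_def field_simps)
qed

lemma has_bochner_integral_FTC_atLeast:
  fixes f F :: "real \<Rightarrow> real"
  assumes f: "f \<in> borel_measurable borel"
    and deriv: "\<And>x. a \<le> x \<Longrightarrow> (F has_real_derivative f x) (at x)"
    and nonneg: "\<And>x. a \<le> x \<Longrightarrow> 0 \<le> f x"
    and lim: "(F \<longlongrightarrow> T) at_top"
  shows "has_bochner_integral lborel (\<lambda>x. f x * indicator {a..} x) (T - F a)"
proof (rule has_bochner_integral_nn_integral)
  have "eventually (\<lambda>x. F a \<le> F x) at_top"
    using eventually_ge_at_top[of a]
  proof eventually_elim
    case (elim x)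
    then show ?case
      using deriv nonneg by (intro DERIV_nonneg_imp_nondecreasing[of a x F]) blast+
  qed
  then have "F a \<le> T"
    by (intro tendsto_lowerbound[OF lim]) auto
  then show "0 \<le> T - F a" by simp
  have "(\<integral>\<^sup>+ x. ennreal (f x * indicator {a..} x) \<partial>lborel)
    = (\<integral>\<^sup>+ x. ennreal (f x) * indicator {a..} x \<partial>lborel)"
    by (intro nn_integral_cong) (auto split: split_indicator)
  also have "\<dots> = ennreal (T - F a)"
    using nn_integral_FTC_atLeast[OF f deriv nonneg lim] by simp
  finally show "(\<integral>\<^sup>+ x. ennreal (f x * indicator {a..} x) \<partial>lborel) = ennreal (T - F a)" .
qed (use f nonneg in \<open>auto split: split_indicator\<close>)

lemma has_bochner_integral_exp_atLeast:
  fixes b :: real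
  assumes "0 < b"
  shows "has_bochner_integral lborel (\<lambda>t. exp (- (b * t)) * indicator {0..} t) (1 / b)"
proof -
  have "((\<lambda>t. - exp (- (b * t)) / b) \<longlongrightarrow> 0) at_top"
    using assms by real_asymp
  then have "has_bochner_integral lborel (\<lambda>t. exp (- (b * t)) * indicator {0..} t)
    (0 - - exp (- (b * 0)) / b)"
    using assms by (intro has_bochner_integral_FTC_atLeast) (auto intro!: derivative_eq_intros)
  then show ?thesis by simp
qed

lemma has_bochner_integral_exp_Icc:
  assumes "0 \<le> x"
  shows "has_bochner_integral lborel (\<lambda>t. exp (- (a * t)) * indicator {..x} t * indicator {0..} t)
    (exp_primitive a x)"
proof -
  have "has_bochner_integral lborel (\<lambda>t. exp (- (a * t)) * indicator {0..x} t)
    (exp_primitive a x - exp_primitive a 0)"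
    using assms by (intro has_bochner_integral_FTC_Icc_real)
      (auto intro!: derivative_eq_intros continuous_intros)
  moreover have "exp (- (a * t)) * indicator {0..x} t
    = exp (- (a * t)) * indicator {..x} t * indicator {0..} t" for t
    by (auto split: split_indicator)
  ultimately show ?thesis by simp
qed

definition survivors :: "nat \<Rightarrow> (nat \<Rightarrow> real) \<Rightarrow> real \<Rightarrow> nat" where
  "survivors n x t = card {i. i < n \<and> t \<le> x i}"

lemma survivors_le: "survivors n x t \<le> n"
  using card_mono[of "{..<n}" "{i. i < n \<and> t \<le> x i}"] by (auto simp: survivors_def)

lemma survivors_eq_sum: "real (survivors n x t) = (\<Sum>i<n. indicator {..x i} t)"
proof -
  have "(\<Sum>i<n. indicator {..x i} t) = (\<Sum>i\<in>{..<n} \<inter> {i. t \<le> x i}. 1 :: real)"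
    by (subst sum.inter_restrict) (auto intro!: sum.cong)
  moreover have "{..<n} \<inter> {i. t \<le> x i} = {i. i < n \<and> t \<le> x i}" by auto
  ultimately show ?thesis by (simp add: survivors_def)
qed

text \<open>
  A \<open>k\<close>-subset has its minimum at level \<open>t\<close> or above exactly if it is chosen among the survivors.
\<close>

lemma sum_indicator_Min:
  assumes "1 \<le> k"
  shows "(\<Sum>S\<in>k_subsets k n. indicator {..Min (x ` S)} t) = real (survivors n x t choose k)"
proof -
  let ?A = "{i. i < n \<and> t \<le> x i}"
  have "indicator {..Min (x ` S)} t = (if S \<subseteq> ?A then 1 else 0 :: real)"
    if "S \<in> k_subsets k n" for S
  proof -
    have "finite S" "S \<noteq> {}" "S \<subseteq> {..<n}"
      using k_subsetsD[OF that] assms by auto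
    then show ?thesis
      by (auto simp: indicator_def)
  qed
  then have "(\<Sum>S\<in>k_subsets k n. indicator {..Min (x ` S)} t)
    = (\<Sum>S\<in>k_subsets k n. if S \<subseteq> ?A then 1 else 0 :: real)"
    by (intro sum.cong) auto
  also have "\<dots> = real (card (k_subsets k n \<inter> {S. S \<subseteq> ?A}))"
    by (subst sum.If_cases) (auto simp: finite_k_subsets)
  also have "k_subsets k n \<inter> {S. S \<subseteq> ?A} = {S. S \<subseteq> ?A \<and> card S = k}"
    by (auto simp: k_subsets_def)
  also have "card \<dots> = survivors n x t choose k"
    by (simp add: survivors_def n_subsets)
  finally show ?thesis .
qed

lemma has_bochner_integral_survivors:
  assumes "\<And>i. i < n \<Longrightarrow> 0 \<le> x i"
  shows "has_bochner_integral lborel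
    (\<lambda>t. exp (- (a * t)) * (real (survivors n x t) / real n) * indicator {0..} t)
    (sample_mean n (\<lambda>i. exp_primitive a (x i)))"
proof -
  have "has_bochner_integral lborel
    (\<lambda>t. (\<Sum>i<n. exp (- (a * t)) * indicator {..x i} t * indicator {0..} t) / real n)
    ((\<Sum>i<n. exp_primitive a (x i)) / real n)"
    using assms
    by (intro has_bochner_integral_divide_zero has_bochner_integral_sum has_bochner_integral_exp_Icc) auto
  moreover have "(\<Sum>i<n. exp (- (a * t)) * indicator {..x i} t * indicator {0..} t) / real n
    = exp (- (a * t)) * (real (survivors n x t) / real n) * indicator {0..} t" for t
    unfolding survivors_eq_sum sum_distrib_left[symmetric] sum_distrib_right[symmetric] by simp
  ultimately show ?thesis
    unfolding sample_mean_def by (simp only:)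
qed

lemma has_bochner_integral_mean_min:
  assumes "1 \<le> k" "\<And>i. i < n \<Longrightarrow> 0 \<le> x i"
  shows "has_bochner_integral lborel
    (\<lambda>t. real (survivors n x t choose k) / real (n choose k) * indicator {0..} t)
    (mean_min k n x)"
proof -
  have "has_bochner_integral lborel (\<lambda>t. indicator {..Min (x ` S)} t * indicator {0..} t :: real)
      (Min (x ` S))"
    if S: "S \<in> k_subsets k n" for S
  proof -
    have "finite S" "S \<noteq> {}" "S \<subseteq> {..<n}"
      using k_subsetsD[OF S] assms(1) by auto
    then have "0 \<le> Min (x ` S)"
      using assms(2) by (subst Min_ge_iff) auto
    from has_bochner_integral_exp_Icc[OF this, of 0] show ?thesis by simp
  qed
  then have "has_bochner_integral lborel
    (\<lambda>t. (\<Sum>S\<in>k_subsets k n. indicator {..Min (x ` S)} t * indicator {0..} t) / real (n choose k))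
    ((\<Sum>S\<in>k_subsets k n. Min (x ` S)) / real (n choose k))"
    by (intro has_bochner_integral_divide_zero has_bochner_integral_sum) auto
  then show ?thesis
    unfolding mean_min_def sum_indicator_Min[OF assms(1), symmetric]
    by (simp add: sum_distrib_right sum_divide_distrib)
qed

text \<open>
  The squared \<open>L\<^sup>2\<close> distance between the empirical survival function and \<open>exp (- l t)\<close>, multiplied
  out and integrated term by term. In this form its expectation needs no exchange of integrals.
\<close>
definition survival_distance :: "real \<Rightarrow> nat \<Rightarrow> (nat \<Rightarrow> real) \<Rightarrow> real" where
  "survival_distance l n x = (\<Sum>i<n. \<Sum>j<n. min (x i) (x j)) / (real n)\<^sup>2
     - 2 * sample_mean n (\<lambda>i. exp_primitive l (x i)) + 1 / (2 * l)"

lemma has_bochner_integral_survival_distance: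
  assumes "0 < l" "\<And>i. i < n \<Longrightarrow> 0 \<le> x i"
  shows "has_bochner_integral lborel
    (\<lambda>t. (real (survivors n x t) / real n - exp (- (l * t)))\<^sup>2 * indicator {0..} t)
    (survival_distance l n x)"
proof -
  have pair: "has_bochner_integral lborel
    (\<lambda>t. indicator {..x i} t * indicator {..x j} t * indicator {0..} t :: real) (min (x i) (x j))"
    if "i < n" "j < n" for i j
  proof -
    have "0 \<le> min (x i) (x j)" using assms(2) that by simp
    from has_bochner_integral_exp_Icc[OF this, of 0] show ?thesis
      by (simp add: indicator_inter_arith[symmetric])
  qed
  have "has_bochner_integral lborel
    (\<lambda>t. (\<Sum>i<n. \<Sum>j<n. indicator {..x i} t * indicator {..x j} t * indicator {0..} t) / (real n)\<^sup>2
      - 2 * (exp (- (l * t)) * (real (survivors n x t) / real n) * indicator {0..} t)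
      + exp (- ((2 * l) * t)) * indicator {0..} t)
    (survival_distance l n x)"
    unfolding survival_distance_def using assms pair
    by (intro has_bochner_integral_add has_bochner_integral_diff has_bochner_integral_divide_zero
          has_bochner_integral_sum has_bochner_integral_mult_right has_bochner_integral_survivors
          has_bochner_integral_exp_atLeast)
       auto
  moreover have "(\<Sum>i<n. \<Sum>j<n. indicator {..x i} t * indicator {..x j} t * indicator {0..} t) / (real n)\<^sup>2
      - 2 * (exp (- (l * t)) * (real (survivors n x t) / real n) * indicator {0..} t)
      + exp (- ((2 * l) * t)) * indicator {0..} t
    = (real (survivors n x t) / real n - exp (- (l * t)))\<^sup>2 * indicator {0..} t" for t
  proof -
    have "(\<Sum>i<n. \<Sum>j<n. indicator {..x i} t * indicator {..x j} t * indicator {0..} t)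
      = (real (survivors n x t))\<^sup>2 * indicator {0..} t"
      unfolding survivors_eq_sum power2_eq_square sum_product by (simp only: sum_distrib_right)
    moreover have "exp (- ((2 * l) * t)) = (exp (- (l * t)))\<^sup>2"
      by (simp add: power2_eq_square exp_add[symmetric])
    ultimately show ?thesis
      by (simp add: power2_diff power_divide algebra_simps)
  qed
  ultimately show ?thesis by simp
qed

text \<open>
  Integrating the pointwise bounds on \<open>(N t choose k) / (n choose k)\<close> over all levels. The number
  \<open>1 / (k l)\<close> is the integral of \<open>exp (- l t) ^ k\<close>, the expected minimum of \<open>k\<close> exponentials.
\<close>

lemma mean_min_approx:
  assumes "0 < l" "1 \<le> k" "k < n" "\<And>i. i < n \<Longrightarrow> 0 \<le> x i"
  shows "\<bar>mean_min k n x - 1 / (real k * l)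
      - real k * (sample_mean n (\<lambda>i. exp_primitive ((real k - 1) * l) (x i)) - 1 / (real k * l))\<bar>
    \<le> (real k)\<^sup>2 / (real n - real k) * sample_mean n x + (real k)\<^sup>2 * survival_distance l n x"
    (is "\<bar>?L\<bar> \<le> ?R")
proof -
  let ?p = "\<lambda>t. real (survivors n x t) / real n"
  let ?I = "indicator {0..} :: real \<Rightarrow> real"
  let ?f = "\<lambda>t. real (survivors n x t choose k) / real (n choose k) * ?I t
      - exp (- ((real k * l) * t)) * ?I t
      - real k * (exp (- (((real k - 1) * l) * t)) * ?p t * ?I t - exp (- ((real k * l) * t)) * ?I t)"
  let ?g = "\<lambda>t. (real k)\<^sup>2 / (real n - real k) * (exp (- (0 * t)) * ?p t * ?I t)
      + (real k)\<^sup>2 * ((?p t - exp (- (l * t)))\<^sup>2 * ?I t)"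
  have f: "has_bochner_integral lborel ?f ?L"
    using assms
    by (intro has_bochner_integral_diff has_bochner_integral_mult_right
          has_bochner_integral_survivors has_bochner_integral_exp_atLeast
          has_bochner_integral_mean_min) auto
  have "has_bochner_integral lborel ?g ((real k)\<^sup>2 / (real n - real k)
      * sample_mean n (\<lambda>i. exp_primitive 0 (x i)) + (real k)\<^sup>2 * survival_distance l n x)"
    using assms
    by (intro has_bochner_integral_add has_bochner_integral_mult_right
          has_bochner_integral_survivors has_bochner_integral_survival_distance) auto
  then have g: "has_bochner_integral lborel ?g ?R" by simp
  have "\<bar>?f t\<bar> \<le> ?g t" for t
  proof (cases "0 \<le> t")
    case True
    define q where "q = exp (- (l * t))"
    have q: "0 \<le> q" "q \<le> 1"
      using True assms(1) by (auto simp: q_def)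
    have p: "0 \<le> ?p t" "?p t \<le> 1"
      using survivors_le[of n x t] assms(3) by auto
    have pow: "exp (- ((real m * l) * t)) = q ^ m" for m
      by (simp add: q_def exp_of_nat_mult[symmetric] mult_ac)
    have "real k - 1 = real (k - 1)"
      using assms(2) by simp
    then have pow1: "exp (- (((real k - 1) * l) * t)) = q ^ (k - 1)"
      by (simp only: pow)
    have "q ^ k = q ^ (k - 1) * q"
      using assms(2) by (metis Suc_diff_le diff_Suc_1 power_Suc2 One_nat_def)
    \<comment> \<open>The first bracket is the cost of sampling without replacement, the second the Taylor remainder.\<close>
    then have f_eq: "?f t = (real (survivors n x t choose k) / real (n choose k) - ?p t ^ k)
        + (?p t ^ k - q ^ k - real k * q ^ (k - 1) * (?p t - q))"
      using True unfolding pow pow1 by (simp add: algebra_simps)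
    have "\<bar>real (survivors n x t choose k) / real (n choose k) - ?p t ^ k\<bar>
        \<le> (real k)\<^sup>2 / (real n - real k) * ?p t"
      using assms survivors_le by (intro binomial_ratio_approx)
    moreover have "\<bar>?p t ^ k - q ^ k - real k * q ^ (k - 1) * (?p t - q)\<bar> \<le> (real k)\<^sup>2 * (?p t - q)\<^sup>2"
      using p q by (intro power_linearization)
    ultimately show ?thesis
      unfolding f_eq using True by (simp add: q_def)
  qed simp
  then have "norm (integral\<^sup>L lborel ?f) \<le> integral\<^sup>L lborel ?g"
    by (intro Bochner_Integration.integral_norm_bound_integral[OF integrable.intros[OF f] integrable.intros[OF g]])
      (simp only: real_norm_def)
  then show ?thesis
    unfolding has_bochner_integral_integral_eq[OF f] has_bochner_integral_integral_eq[OF g]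
    by simp
qed

section \<open>Convergence in distribution under small perturbations\<close>

lemma norm_iexp_diff_le:
  "norm (iexp (t * a) - iexp (t * b)) \<le> (2 + \<bar>t\<bar>) * min 1 \<bar>a - b\<bar>"
proof -
  have "iexp (t * a) - iexp (t * b) = iexp (t * b) * (iexp (t * a - t * b) - 1)"
    by (simp add: algebra_simps exp_add[symmetric])
  then have eq: "norm (iexp (t * a) - iexp (t * b)) = norm (iexp (t * a - t * b) - 1)"
    by (simp add: norm_mult)
  have "norm (iexp (t * a - t * b) - 1) \<le> \<bar>t * a - t * b\<bar>"
    using iexp_approx1[of "t * a - t * b" 0] by simp
  moreover have "\<bar>t * a - t * b\<bar> = \<bar>t\<bar> * \<bar>a - b\<bar>"
    by (simp add: abs_mult[symmetric] right_diff_distrib)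
  moreover have "norm (iexp (t * a - t * b) - 1) \<le> 2"
    using norm_triangle_ineq4[of "iexp (t * a - t * b)" 1] by simp
  moreover have "N \<le> (2 + \<bar>t\<bar>) * min 1 d" if "N \<le> \<bar>t\<bar> * d" "N \<le> 2" "0 \<le> d" for N d :: real
    using that by (cases "1 \<le> d") (auto simp: min_def distrib_right)
  ultimately show ?thesis
    unfolding eq by simp
qed

text \<open>
  A form of Slutsky's theorem. Truncating the difference at \<open>1\<close> lets a single bound in mean cover
  both a small error and an exceptional event of small probability.
\<close>

lemma (in prob_space) weak_conv_m_of_close:
  fixes A B W :: "nat \<Rightarrow> 'a \<Rightarrow> real"
  assumes A [measurable]: "\<And>n. A n \<in> borel_measurable M"
    and B [measurable]: "\<And>n. B n \<in> borel_measurable M"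
    and \<mu>: "real_distribution \<mu>"
    and conv: "weak_conv_m (\<lambda>n. distr M borel (B n)) \<mu>"
    and W: "\<And>n. integrable M (W n)"
    and close: "\<forall>\<^sub>F n in sequentially. AE \<omega> in M. min 1 \<bar>A n \<omega> - B n \<omega>\<bar> \<le> W n \<omega>"
    and lim: "(\<lambda>n. expectation (W n)) \<longlonglongrightarrow> 0"
  shows "weak_conv_m (\<lambda>n. distr M borel (A n)) \<mu>"
proof (rule levy_continuity)
  fix t
  have charB: "(\<lambda>n. char (distr M borel (B n)) t) \<longlonglongrightarrow> char \<mu> t"
    using \<mu> conv by (intro levy_continuity1) (auto intro: real_distribution_distr)
  have "\<forall>\<^sub>F n in sequentially. norm (char (distr M borel (A n)) t - char (distr M borel (B n)) t)
      \<le> (2 + \<bar>t\<bar>) * expectation (W n)"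
    using close
  proof eventually_elim
    case (elim n)
    have iA: "integrable M (\<lambda>\<omega>. iexp (t * A n \<omega>))" and iB: "integrable M (\<lambda>\<omega>. iexp (t * B n \<omega>))"
      by (auto intro!: integrable_iexp)
    have "char (distr M borel (A n)) t - char (distr M borel (B n)) t
      = (CLINT \<omega>|M. iexp (t * A n \<omega>) - iexp (t * B n \<omega>))"
      using iA iB by (simp add: char_def integral_distr)
    also have "norm \<dots> \<le> (\<integral>\<omega>. norm (iexp (t * A n \<omega>) - iexp (t * B n \<omega>)) \<partial>M)"
      by (rule integral_norm_bound)
    also have "\<dots> \<le> (\<integral>\<omega>. (2 + \<bar>t\<bar>) * W n \<omega> \<partial>M)"
    proof (rule integral_mono_AE)
      show "AE \<omega> in M. norm (iexp (t * A n \<omega>) - iexp (t * B n \<omega>)) \<le> (2 + \<bar>t\<bar>) * W n \<omega>"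
        using elim
      proof eventually_elim
        case (elim \<omega>)
        then have "(2 + \<bar>t\<bar>) * min 1 \<bar>A n \<omega> - B n \<omega>\<bar> \<le> (2 + \<bar>t\<bar>) * W n \<omega>"
          by (intro mult_left_mono) auto
        then show ?case
          using norm_iexp_diff_le order_trans by blast
      qed
    qed (use iA iB W in auto)
    finally show ?case by simp
  qed
  moreover have "(\<lambda>n. (2 + \<bar>t\<bar>) * expectation (W n)) \<longlonglongrightarrow> 0"
    using tendsto_mult_right_zero[OF lim] by simp
  ultimately have "(\<lambda>n. char (distr M borel (A n)) t - char (distr M borel (B n)) t) \<longlonglongrightarrow> 0"
    by (rule Lim_null_comparison)
  from tendsto_add[OF this charB] show "(\<lambda>n. char (distr M borel (A n)) t) \<longlonglongrightarrow> char \<mu> t"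
    by simp
qed (use \<mu> in \<open>auto intro: real_distribution_distr\<close>)

lemma (in prob_space) weak_conv_m_scale_normal:
  fixes T :: "nat \<Rightarrow> 'a \<Rightarrow> real"
  assumes T [measurable]: "\<And>n. T n \<in> borel_measurable M"
    and conv: "weak_conv_m (\<lambda>n. distr M borel (T n)) std_normal_distribution"
    and "0 < c"
  shows "weak_conv_m (\<lambda>n. distr M borel (\<lambda>\<omega>. c * T n \<omega>)) (density lborel (normal_density 0 c))"
proof (rule levy_continuity)
  interpret std: real_distribution std_normal_distribution
    by (rule real_dist_normal_dist)
  have "distributed std_normal_distribution lborel (\<lambda>x. x) (normal_density 0 1)"
    by (auto simp: distributed_def distr_id2)
  from std.normal_density_affine[OF this, of c 0]
  have *: "distr std_normal_distribution lborel (\<lambda>x. c * x) = density lborel (normal_density 0 c)"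
    using assms(3) by (simp add: distributed_def)
  have normal: "density lborel (normal_density 0 c) = distr std_normal_distribution borel (\<lambda>x. c * x)"
    unfolding *[symmetric] by (rule distr_cong) auto
  show "real_distribution (density lborel (normal_density 0 c))"
    unfolding normal by (intro std.real_distribution_distr) auto
  fix t
  have "(\<lambda>n. char (distr M borel (T n)) (t * c)) \<longlonglongrightarrow> char std_normal_distribution (t * c)"
    using conv by (intro levy_continuity1) (auto intro: real_distribution_distr real_dist_normal_dist)
  moreover have "char (distr M borel (\<lambda>\<omega>. c * T n \<omega>)) t = char (distr M borel (T n)) (t * c)" for n
    by (simp add: char_def integral_distr mult_ac)
  moreover have "char (density lborel (normal_density 0 c)) t = char std_normal_distribution (t * c)"
    unfolding normal by (simp add: char_def integral_distr mult_ac)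
  ultimately show "(\<lambda>n. char (distr M borel (\<lambda>\<omega>. c * T n \<omega>)) t)
      \<longlonglongrightarrow> char (density lborel (normal_density 0 c)) t"
    by simp
qed (auto intro: real_distribution_distr)

lemma (in prob_space) second_moment_indep_sum:
  fixes Y :: "'i \<Rightarrow> 'a \<Rightarrow> real"
  assumes "finite I" "indep_vars (\<lambda>_. borel) Y I"
    and "\<And>i. i \<in> I \<Longrightarrow> integrable M (\<lambda>\<omega>. (Y i \<omega>)\<^sup>2)"
    and "\<And>i. i \<in> I \<Longrightarrow> expectation (Y i) = 0"
  shows "integrable M (\<lambda>\<omega>. (\<Sum>i\<in>I. Y i \<omega>)\<^sup>2)"
    and "expectation (\<lambda>\<omega>. (\<Sum>i\<in>I. Y i \<omega>)\<^sup>2) = (\<Sum>i\<in>I. expectation (\<lambda>\<omega>. (Y i \<omega>)\<^sup>2))"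
proof -
  have "integrable M (\<lambda>\<omega>. (\<Sum>i\<in>I. Y i \<omega>)\<^sup>2) \<and>
    expectation (\<lambda>\<omega>. (\<Sum>i\<in>I. Y i \<omega>)\<^sup>2) = (\<Sum>i\<in>I. expectation (\<lambda>\<omega>. (Y i \<omega>)\<^sup>2))"
    using assms
  proof (induction I rule: finite_induct)
    case (insert i I)
    let ?S = "\<lambda>\<omega>. \<Sum>i\<in>I. Y i \<omega>"
    have rv [measurable]: "Y j \<in> borel_measurable M" if "j \<in> insert i I" for j
      using insert.prems(1) that by (auto simp: indep_vars_def)
    have int: "integrable M (Y j)" if "j \<in> insert i I" for j
      using square_integrable_imp_integrable[OF rv[OF that] insert.prems(2)[OF that]] .
    have IH: "integrable M (\<lambda>\<omega>. (?S \<omega>)\<^sup>2)"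
      "expectation (\<lambda>\<omega>. (?S \<omega>)\<^sup>2) = (\<Sum>i\<in>I. expectation (\<lambda>\<omega>. (Y i \<omega>)\<^sup>2))"
      using insert.IH[OF indep_vars_subset[OF insert.prems(1)]] insert.prems by simp_all blast+
    have "indep_var borel (Y i) borel ?S"
      by (rule indep_vars_sum[OF insert.hyps insert.prems(1)])
    moreover have iS: "integrable M ?S"
      by (intro Bochner_Integration.integrable_sum int) simp
    ultimately have cross: "integrable M (\<lambda>\<omega>. Y i \<omega> * ?S \<omega>)"
      "expectation (\<lambda>\<omega>. Y i \<omega> * ?S \<omega>) = expectation (Y i) * expectation ?S"
      using int by (simp_all add: indep_var_integrable indep_var_lebesgue_integral)
    have "(\<Sum>i\<in>insert i I. Y i \<omega>)\<^sup>2 = (Y i \<omega>)\<^sup>2 + 2 * (Y i \<omega> * ?S \<omega>) + (?S \<omega>)\<^sup>2" for \<omega>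
      using insert.hyps by (simp add: power2_sum)
    then show ?case
      using IH cross insert.prems(2)[of i] insert.prems(3)[of i] insert.hyps by simp
  qed simp
  then show "integrable M (\<lambda>\<omega>. (\<Sum>i\<in>I. Y i \<omega>)\<^sup>2)"
    "expectation (\<lambda>\<omega>. (\<Sum>i\<in>I. Y i \<omega>)\<^sup>2) = (\<Sum>i\<in>I. expectation (\<lambda>\<omega>. (Y i \<omega>)\<^sup>2))"
    by auto
qed

section \<open>Moments of exponential variables\<close>

lemma (in prob_space) exponential_expectation_FTC:
  fixes g G :: "real \<Rightarrow> real"
  assumes l: "0 < l" and D: "distributed M lborel X (exponential_density l)"
    and g [measurable]: "g \<in> borel_measurable borel" and nonneg: "\<And>x. 0 \<le> x \<Longrightarrow> 0 \<le> g x"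
    and deriv: "\<And>x. (G has_real_derivative l * exp (- (l * x)) * g x) (at x)"
    and lim: "(G \<longlongrightarrow> 0) at_top"
  shows "integrable M (\<lambda>\<omega>. g (X \<omega>))" "expectation (\<lambda>\<omega>. g (X \<omega>)) = - G 0"
proof -
  have "has_bochner_integral lborel (\<lambda>x. l * exp (- (l * x)) * g x * indicator {0..} x) (0 - G 0)"
    using l nonneg deriv lim by (intro has_bochner_integral_FTC_atLeast) auto
  moreover have "l * exp (- (l * x)) * g x * indicator {0..} x = exponential_density l x * g x" for x
    by (auto simp: exponential_density_def mult_ac)
  ultimately have "has_bochner_integral lborel (\<lambda>x. exponential_density l x * g x) (- G 0)"
    by simp
  then have "integrable lborel (\<lambda>x. exponential_density l x * g x)"
      "(\<integral>x. exponential_density l x * g x \<partial>lborel) = - G 0"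
    by (auto simp: has_bochner_integral_iff)
  moreover have "\<And>x. 0 \<le> exponential_density l x"
    using l by (rule exponential_density_nonneg)
  ultimately show "integrable M (\<lambda>\<omega>. g (X \<omega>))" "expectation (\<lambda>\<omega>. g (X \<omega>)) = - G 0"
    using distributed_integrable[OF D, of g] distributed_integral[OF D, of g] by auto
qed

lemma DERIV_exp_decay: "((\<lambda>x. exp (- (c * x))) has_real_derivative - (c * exp (- (c * x)))) (at x)"
  by (auto intro!: derivative_eq_intros)

lemma tendsto_exp_decay: "0 < c \<Longrightarrow> ((\<lambda>x. exp (- (c * x))) \<longlongrightarrow> 0) at_top" for c :: real
  by real_asymp

lemma tendsto_exp_decay_mult_square:
  fixes c :: real
  assumes "0 < c"
  shows "((\<lambda>x. exp (- (c * x)) * (1 + x\<^sup>2)) \<longlongrightarrow> 0) at_top"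
  using assms by real_asymp

lemma tendsto_exp_decay_mult_exp_primitive:
  assumes "0 < c" "0 \<le> a" "0 \<le> b"
  shows "((\<lambda>x. exp (- (c * x)) * exp_primitive a x) \<longlongrightarrow> 0) at_top"
    and "((\<lambda>x. exp (- (c * x)) * (exp_primitive a x * exp_primitive b x)) \<longlongrightarrow> 0) at_top"
proof -
  have bound: "exp_primitive a x \<le> 1 + x\<^sup>2" "exp_primitive a x * exp_primitive b x \<le> 1 + x\<^sup>2" if "0 \<le> x" for x
  proof -
    have "x \<le> 1 + x\<^sup>2"
      using sum_squares_bound[of x 1] that by simp
    then show "exp_primitive a x \<le> 1 + x\<^sup>2"
      using exp_primitive_bounds[OF assms(2) that] by linarith
    have "exp_primitive a x * exp_primitive b x \<le> x * x"
      using exp_primitive_bounds assms that by (intro mult_mono) auto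
    then show "exp_primitive a x * exp_primitive b x \<le> 1 + x\<^sup>2"
      by (simp add: power2_eq_square)
  qed
  show "((\<lambda>x. exp (- (c * x)) * exp_primitive a x) \<longlongrightarrow> 0) at_top"
    "((\<lambda>x. exp (- (c * x)) * (exp_primitive a x * exp_primitive b x)) \<longlongrightarrow> 0) at_top"
    by (rule Lim_null_comparison[OF _ tendsto_exp_decay_mult_square[OF assms(1)]],
        use eventually_ge_at_top[of 0] in eventually_elim,
        use assms exp_primitive_bounds bound in \<open>auto simp: abs_mult intro!: mult_left_mono\<close>)+
qed

text \<open>
  Integration by parts supplies the antiderivative \<open>G\<close>, for every rate \<open>a \<ge> 0\<close> uniformly.
\<close>

lemma (in prob_space) exponential_mean_exp_primitive:
  assumes l: "0 < l" and D: "distributed M lborel X (exponential_density l)" and a: "0 \<le> a"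
  shows "integrable M (\<lambda>\<omega>. exp_primitive a (X \<omega>))"
    and "expectation (\<lambda>\<omega>. exp_primitive a (X \<omega>)) = 1 / (a + l)"
proof -
  define \<alpha> where "\<alpha> = 1 / (a + l)"
  have \<alpha>: "(a + l) * \<alpha> = 1" using assms by (simp add: \<alpha>_def)
  define G where "G = (\<lambda>x. - (exp (- (l * x)) * exp_primitive a x) - exp (- ((a + l) * x)) * \<alpha>)"
  have deriv: "(G has_real_derivative l * exp (- (l * x)) * exp_primitive a x) (at x)" for x
  proof -
    have split: "exp (- ((a + l) * x)) = exp (- (l * x)) * exp (- (a * x))"
      by (simp add: exp_add[symmetric] algebra_simps)
    have "(G has_real_derivative
        - (- (l * exp (- (l * x))) * exp_primitive a x + exp (- (a * x)) * exp (- (l * x)))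
        - (- ((a + l) * exp (- ((a + l) * x)))) * \<alpha>) (at x)"
      unfolding G_def by (intro DERIV_diff DERIV_minus DERIV_mult DERIV_cmult_right DERIV_exp_primitive DERIV_exp_decay)
    also have "- (- (l * exp (- (l * x))) * exp_primitive a x + exp (- (a * x)) * exp (- (l * x)))
        - (- ((a + l) * exp (- ((a + l) * x)))) * \<alpha>
      = l * exp (- (l * x)) * exp_primitive a x"
      using \<alpha> unfolding split by algebra
    finally show ?thesis .
  qed
  have "(G \<longlongrightarrow> - 0 - 0 * \<alpha>) at_top"
    unfolding G_def using assms
    by (intro tendsto_diff tendsto_minus tendsto_mult_right tendsto_exp_decay
        tendsto_exp_decay_mult_exp_primitive) auto
  then have lim: "(G \<longlongrightarrow> 0) at_top" by simp
  note * = exponential_expectation_FTC[OF l D _ _ deriv lim]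
  show "integrable M (\<lambda>\<omega>. exp_primitive a (X \<omega>))"
    by (rule *) (use a exp_primitive_bounds in auto)
  have "expectation (\<lambda>\<omega>. exp_primitive a (X \<omega>)) = - G 0"
    by (rule *) (use a exp_primitive_bounds in auto)
  then show "expectation (\<lambda>\<omega>. exp_primitive a (X \<omega>)) = 1 / (a + l)"
    by (simp add: G_def \<alpha>_def)
qed

text \<open>
  Two integrations by parts produce the antiderivative \<open>G\<close>: each derivative of a factor
  \<open>exp_primitive a\<close> turns the decay rate \<open>l\<close> into \<open>a + l\<close>.
\<close>

lemma (in prob_space) exponential_mean_exp_primitive_mult:
  assumes l: "0 < l" and D: "distributed M lborel X (exponential_density l)" and a: "0 \<le> a" and b: "0 \<le> b"
  shows "integrable M (\<lambda>\<omega>. exp_primitive a (X \<omega>) * exp_primitive b (X \<omega>))"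
    and "expectation (\<lambda>\<omega>. exp_primitive a (X \<omega>) * exp_primitive b (X \<omega>))
      = (1 / (a + l) + 1 / (b + l)) / (a + b + l)"
proof -
  define \<alpha> \<beta> \<gamma> where "\<alpha> = 1 / (a + l)" and "\<beta> = 1 / (b + l)" and "\<gamma> = (\<alpha> + \<beta>) / (a + b + l)"
  have coeff: "(a + l) * \<alpha> = 1" "(b + l) * \<beta> = 1" "(a + b + l) * \<gamma> = \<alpha> + \<beta>"
    using assms by (simp_all add: \<alpha>_def \<beta>_def \<gamma>_def)
  define G where "G = (\<lambda>x. - (exp (- (l * x)) * (exp_primitive a x * exp_primitive b x))
    - exp (- ((a + l) * x)) * exp_primitive b x * \<alpha>
    - exp (- ((b + l) * x)) * exp_primitive a x * \<beta>
    - exp (- ((a + b + l) * x)) * \<gamma>)"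
  have deriv: "(G has_real_derivative l * exp (- (l * x)) * (exp_primitive a x * exp_primitive b x)) (at x)" for x
  proof -
    define u v w where "u = exp (- (l * x))" and "v = exp (- (a * x))" and "w = exp (- (b * x))"
    have split: "exp (- ((a + l) * x)) = u * v" "exp (- ((b + l) * x)) = u * w"
      "exp (- ((a + b + l) * x)) = u * v * w"
      by (simp_all add: u_def v_def w_def exp_add[symmetric] algebra_simps)
    have "(G has_real_derivative
        - (- (l * u) * (exp_primitive a x * exp_primitive b x)
            + (v * exp_primitive b x + w * exp_primitive a x) * u)
        - (- ((a + l) * exp (- ((a + l) * x))) * exp_primitive b x + w * exp (- ((a + l) * x))) * \<alpha>
        - (- ((b + l) * exp (- ((b + l) * x))) * exp_primitive a x + v * exp (- ((b + l) * x))) * \<beta>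
        - (- ((a + b + l) * exp (- ((a + b + l) * x)))) * \<gamma>) (at x)"
      unfolding G_def u_def v_def w_def
      by (intro DERIV_diff DERIV_minus DERIV_mult DERIV_cmult_right DERIV_exp_primitive DERIV_exp_decay)
    also have "- (- (l * u) * (exp_primitive a x * exp_primitive b x)
            + (v * exp_primitive b x + w * exp_primitive a x) * u)
        - (- ((a + l) * exp (- ((a + l) * x))) * exp_primitive b x + w * exp (- ((a + l) * x))) * \<alpha>
        - (- ((b + l) * exp (- ((b + l) * x))) * exp_primitive a x + v * exp (- ((b + l) * x))) * \<beta>
        - (- ((a + b + l) * exp (- ((a + b + l) * x)))) * \<gamma>
      = l * u * (exp_primitive a x * exp_primitive b x)"
      using coeff unfolding split by algebra
    finally show ?thesis unfolding u_def .
  qed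
  have "(G \<longlongrightarrow> - 0 - 0 * \<alpha> - 0 * \<beta> - 0 * \<gamma>) at_top"
    unfolding G_def using assms
    by (intro tendsto_diff tendsto_minus tendsto_mult_right tendsto_exp_decay
        tendsto_exp_decay_mult_exp_primitive) auto
  then have lim: "(G \<longlongrightarrow> 0) at_top" by simp
  note * = exponential_expectation_FTC[OF l D _ _ deriv lim]
  show "integrable M (\<lambda>\<omega>. exp_primitive a (X \<omega>) * exp_primitive b (X \<omega>))"
    by (rule *) (use a b exp_primitive_bounds in auto)
  have "expectation (\<lambda>\<omega>. exp_primitive a (X \<omega>) * exp_primitive b (X \<omega>)) = - G 0"
    by (rule *) (use a b exp_primitive_bounds in auto)
  then show "expectation (\<lambda>\<omega>. exp_primitive a (X \<omega>) * exp_primitive b (X \<omega>))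
      = (1 / (a + l) + 1 / (b + l)) / (a + b + l)"
    by (simp add: G_def \<alpha>_def \<beta>_def \<gamma>_def)
qed

section \<open>Linearization of the statistic\<close>

text \<open>
  The sum of the first-order terms \<open>k\<^sup>2 * (exp_primitive ((k - 1) * l) x - 1 / (k * l))\<close> with sign
  plus for \<open>k = s + 1\<close> and minus for \<open>k = s\<close>; the constants combine to \<open>- 1 / l\<close>.
\<close>
definition influence :: "real \<Rightarrow> nat \<Rightarrow> real \<Rightarrow> real" where
  "influence l s x = (real s + 1)\<^sup>2 * exp_primitive (real s * l) x
     - (real s)\<^sup>2 * exp_primitive ((real s - 1) * l) x - 1 / l"

lemma borel_measurable_influence [measurable]: "influence l s \<in> borel_measurable borel"
  unfolding influence_def[abs_def] by measurable

definition approx_error :: "real \<Rightarrow> nat \<Rightarrow> nat \<Rightarrow> (nat \<Rightarrow> real) \<Rightarrow> real" where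
  "approx_error l k n x =
     (real k)\<^sup>2 / (real n - real k) * sample_mean n x + (real k)\<^sup>2 * survival_distance l n x"

lemma Delta_hat_approx:
  assumes l: "0 < l" and s: "1 \<le> s" and n: "s + 1 < n" and nonneg: "\<And>i. i < n \<Longrightarrow> 0 \<le> x i"
  shows "\<bar>Delta_hat s n x - sample_mean n (\<lambda>i. influence l s (x i))\<bar>
    \<le> (real s + 1) * approx_error l (s + 1) n x + real s * approx_error l s n x"
proof -
  define U where "U = sample_mean n (\<lambda>i. exp_primitive (real s * l) (x i))"
  define V where "V = sample_mean n (\<lambda>i. exp_primitive ((real s - 1) * l) (x i))"
  define a where "a = mean_min (s + 1) n x - 1 / ((real s + 1) * l)
    - (real s + 1) * (U - 1 / ((real s + 1) * l))"
  define b where "b = mean_min s n x - 1 / (real s * l) - real s * (V - 1 / (real s * l))"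
  have a: "\<bar>a\<bar> \<le> approx_error l (s + 1) n x"
    using mean_min_approx[of l "s + 1" n x] assms
    by (simp add: a_def U_def approx_error_def add.commute)
  have b: "\<bar>b\<bar> \<le> approx_error l s n x"
    using mean_min_approx[of l s n x] assms by (simp add: b_def V_def approx_error_def)
  have mean: "sample_mean n (\<lambda>i. influence l s (x i))
    = (real s + 1)\<^sup>2 * U - (real s)\<^sup>2 * V - 1 / l"
    using n by (simp add: sample_mean_def influence_def U_def V_def sum_subtractf
        sum_distrib_left[symmetric] diff_divide_distrib)
  have cancel: "(real s + 1) * (1 / ((real s + 1) * l)) = 1 / l" "real s * (1 / (real s * l)) = 1 / l"
    using s by (simp_all add: add_eq_0_iff)
  have "Delta_hat s n x - sample_mean n (\<lambda>i. influence l s (x i))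
    = (real s + 1) * mean_min (s + 1) n x - real s * mean_min s n x
      - ((real s + 1)\<^sup>2 * U - (real s)\<^sup>2 * V - 1 / l)"
    using Delta_hat_eq_mean_min[of s n x] n unfolding mean by simp
  also have "\<dots> = (real s + 1) * a - real s * b"
    using cancel unfolding a_def b_def by algebra
  also have "\<bar>\<dots>\<bar> \<le> (real s + 1) * \<bar>a\<bar> + real s * \<bar>b\<bar>"
    using abs_triangle_ineq4[of "(real s + 1) * a" "real s * b"] by (simp add: abs_mult)
  also have "\<dots> \<le> (real s + 1) * approx_error l (s + 1) n x + real s * approx_error l s n x"
    using a b by (intro add_mono mult_left_mono) auto
  finally show ?thesis .
qed

text \<open>
  Replacing the denominator \<open>m\<close> by its limit \<open>1 / l\<close>. If \<open>m\<close> is farther than \<open>1 / (2 * l)\<close> from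
  \<open>1 / l\<close>, the last summand is at least \<open>1\<close>; otherwise \<open>1 / m \<le> 2 * l\<close>. The weight \<open>e\<close> balances the
  product of \<open>Z\<close> and \<open>m - 1 / l\<close>: with \<open>Z\<close> of order \<open>1\<close> and \<open>m - 1 / l\<close> of order \<open>1 / sqrt n\<close>,
  \<open>e = sqrt n\<close> makes both terms small.
\<close>

lemma ratio_approx:
  fixes l T Z R m e :: real
  assumes l: "0 < l" and TZ: "\<bar>T - Z\<bar> \<le> R" and e: "0 < e"
  shows "min 1 \<bar>T / m - l * Z\<bar>
    \<le> 2 * l * R + l\<^sup>2 * (Z\<^sup>2 / e + e * (m - 1 / l)\<^sup>2) + 4 * l\<^sup>2 * (m - 1 / l)\<^sup>2"
proof -
  define D where "D = m - 1 / l"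
  have R: "0 \<le> R" using TZ by linarith
  have pos: "0 \<le> 2 * l * R" "0 \<le> l\<^sup>2 * (Z\<^sup>2 / e + e * D\<^sup>2)" "0 \<le> 4 * l\<^sup>2 * D\<^sup>2"
    using l e R by (auto intro!: mult_nonneg_nonneg add_nonneg_nonneg)
  have "min 1 \<bar>T / m - l * Z\<bar> \<le> 2 * l * R + l\<^sup>2 * (Z\<^sup>2 / e + e * D\<^sup>2) + 4 * l\<^sup>2 * D\<^sup>2"
  proof (cases "1 \<le> 2 * l * \<bar>D\<bar>")
    case True
    then have "1\<^sup>2 \<le> (2 * l * \<bar>D\<bar>)\<^sup>2" by (intro power_mono) auto
    then have "1 \<le> 4 * l\<^sup>2 * D\<^sup>2" by (simp add: power_mult_distrib)
    then show ?thesis using pos by linarith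
  next
    case False
    then have "1 / (2 * l) < m"
      using l by (simp add: D_def field_simps abs_if split: if_splits)
    moreover have "0 < 1 / (2 * l)" using l by simp
    ultimately have m: "0 < m" by linarith
    with \<open>1 / (2 * l) < m\<close> have m_inv: "1 / m \<le> 2 * l"
      using l by (simp add: field_simps)
    have "T / m - l * Z = (T - Z) * (1 / m) - l * (Z * D) * (1 / m)"
      using l m by (simp add: D_def field_simps)
    also have "\<bar>\<dots>\<bar> \<le> \<bar>T - Z\<bar> * \<bar>1 / m\<bar> + l * \<bar>Z * D\<bar> * \<bar>1 / m\<bar>"
      using l abs_triangle_ineq4[of "(T - Z) * (1 / m)" "l * (Z * D) * (1 / m)"]
      by (simp only: abs_mult) simp
    also have "\<dots> \<le> R * (2 * l) + l * \<bar>Z * D\<bar> * (2 * l)"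
      using TZ m m_inv l R by (intro add_mono mult_mono) auto
    also have "\<dots> = 2 * l * R + l\<^sup>2 * (2 * \<bar>Z * D\<bar>)"
      by (simp add: power2_eq_square)
    also have "2 * \<bar>Z * D\<bar> \<le> Z\<^sup>2 / e + e * D\<^sup>2"
    proof -
      have "0 \<le> (\<bar>Z\<bar> - e * \<bar>D\<bar>)\<^sup>2 / e" using e by simp
      also have "\<dots> = Z\<^sup>2 / e + e * D\<^sup>2 - 2 * \<bar>Z * D\<bar>"
        using e by (simp add: power2_diff power2_eq_square field_simps abs_mult)
      finally show ?thesis by simp
    qed
    finally have "\<bar>T / m - l * Z\<bar> \<le> 2 * l * R + l\<^sup>2 * (Z\<^sup>2 / e + e * D\<^sup>2)"
      using l by (simp add: mult_left_mono)
    then show ?thesis using pos by linarith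
  qed
  then show ?thesis by (simp add: D_def)
qed

lemma borel_measurable_Delta_hat_star:
  assumes X: "\<And>i. X i \<in> borel_measurable M"
  shows "(\<lambda>\<omega>. Delta_hat_star s n (\<lambda>i. X i \<omega>)) \<in> borel_measurable M"
proof -
  have [measurable]: "(\<lambda>\<omega>. Min ((\<lambda>j. X (f j) \<omega>) ` {..<k})) \<in> borel_measurable M" for f :: "nat \<Rightarrow> nat" and k :: nat
    using X by (intro borel_measurable_Min) auto
  note X [measurable]
  show ?thesis
    unfolding Delta_hat_star_def Delta_hat_def U_statistic_def kernel_def sample_mean_def
    by measurable
qed

section \<open>Exponential samples\<close>

locale exponential_sample = prob_space M for M :: "'a measure" +
  fixes X :: "nat \<Rightarrow> 'a \<Rightarrow> real" and l :: real
  assumes rate_pos: "0 < l"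
    and indep: "indep_vars (\<lambda>_. borel) X UNIV"
    and exponential: "\<And>i. distributed M lborel (X i) (exponential_density l)"
begin

lemma X_measurable [measurable]: "X i \<in> borel_measurable M"
  using distributed_measurable[OF exponential[of i]] by simp

lemma AE_nonneg: "AE \<omega> in M. \<forall>i. 0 \<le> X i \<omega>"
proof -
  have "AE \<omega> in M. 0 < X i \<omega>" for i
    using exponential_distributedD_gt[OF exponential[of i] order_refl rate_pos]
    by (intro prob_Collect_eq_1[THEN iffD1]) auto
  then have "AE \<omega> in M. \<forall>i. 0 < X i \<omega>"
    by (simp add: AE_all_countable)
  then show ?thesis
    by eventually_elim (auto intro: less_imp_le)
qed

lemma indep_transform:
  assumes [measurable]: "g \<in> borel_measurable borel"
  shows "indep_vars (\<lambda>_. borel) (\<lambda>i \<omega>. g (X i \<omega>) :: real) I"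
  by (rule indep_vars_subset[OF indep_vars_compose2[OF indep, where Y = "\<lambda>_. g"]]) auto

lemma sample_mean_exp_primitive:
  assumes "0 \<le> a"
  shows "integrable M (\<lambda>\<omega>. sample_mean n (\<lambda>i. exp_primitive a (X i \<omega>)))"
    and "0 < n \<Longrightarrow> expectation (\<lambda>\<omega>. sample_mean n (\<lambda>i. exp_primitive a (X i \<omega>))) = 1 / (a + l)"
  using exponential_mean_exp_primitive[OF rate_pos exponential assms]
  by (simp_all add: sample_mean_def)

lemma sample_mean_X:
  shows "integrable M (\<lambda>\<omega>. sample_mean n (\<lambda>i. X i \<omega>))"
    and "0 < n \<Longrightarrow> expectation (\<lambda>\<omega>. sample_mean n (\<lambda>i. X i \<omega>)) = 1 / l"
  using sample_mean_exp_primitive[of 0] by simp_all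

lemma pairwise_min:
  shows "integrable M (\<lambda>\<omega>. min (X i \<omega>) (X j \<omega>))"
    and "expectation (\<lambda>\<omega>. min (X i \<omega>) (X j \<omega>)) = 1 / (2 * l) + (if i = j then 1 / (2 * l) else 0)"
proof -
  have int: "integrable M (X i)" for i
    using exponential_mean_exp_primitive[OF rate_pos exponential[of i], of 0] by simp
  show "integrable M (\<lambda>\<omega>. min (X i \<omega>) (X j \<omega>))"
    using int by simp
  show "expectation (\<lambda>\<omega>. min (X i \<omega>) (X j \<omega>)) = 1 / (2 * l) + (if i = j then 1 / (2 * l) else 0)"
  proof (cases "i = j")
    case True
    then show ?thesis
      using exponential_distributed_expectation[OF rate_pos exponential[of j]] by simp
  next
    case False
    have "distributed M lborel (\<lambda>\<omega>. Min ((\<lambda>i. X i \<omega>) ` {i, j})) (exponential_density (\<Sum>i\<in>{i, j}. l))"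
      using indep_vars_subset[OF indep, of "{i, j}"] rate_pos exponential
      by (intro exponential_distributed_Min) auto
    then have "distributed M lborel (\<lambda>\<omega>. min (X i \<omega>) (X j \<omega>)) (exponential_density (2 * l))"
      using False by simp
    then show ?thesis
      using exponential_distributed_expectation[of "2 * l"] rate_pos False by simp
  qed
qed

text \<open>
  Off the diagonal the minimum of two observations has mean \<open>1 / (2 * l)\<close>, which cancels the
  other terms; only the excess of the \<open>n\<close> diagonal terms survives division by \<open>n\<^sup>2\<close>.
\<close>

lemma mean_survival_distance:
  shows "integrable M (\<lambda>\<omega>. survival_distance l n (\<lambda>i. X i \<omega>))"
    and "0 < n \<Longrightarrow> expectation (\<lambda>\<omega>. survival_distance l n (\<lambda>i. X i \<omega>)) = 1 / (2 * l * real n)"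
proof -
  have l: "0 \<le> l" using rate_pos by simp
  note int = sample_mean_exp_primitive(1)[OF l] pairwise_min(1)
  show "integrable M (\<lambda>\<omega>. survival_distance l n (\<lambda>i. X i \<omega>))"
    using int by (simp add: survival_distance_def)
  assume n: "0 < n"
  have "expectation (\<lambda>\<omega>. \<Sum>i<n. \<Sum>j<n. min (X i \<omega>) (X j \<omega>))
    = (\<Sum>i<n. \<Sum>j<n. 1 / (2 * l) + (if i = j then 1 / (2 * l) else 0))"
    using pairwise_min by (simp add: integral_sum)
  also have "\<dots> = real n * real n / (2 * l) + real n / (2 * l)"
    by (simp add: sum.distrib distrib_left)
  finally have "expectation (\<lambda>\<omega>. survival_distance l n (\<lambda>i. X i \<omega>))
    = (real n * real n / (2 * l) + real n / (2 * l)) / (real n)\<^sup>2 - 2 * (1 / (l + l)) + 1 / (2 * l)"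
    using int sample_mean_exp_primitive(2)[OF l n] by (simp add: survival_distance_def prob_space)
  then show "expectation (\<lambda>\<omega>. survival_distance l n (\<lambda>i. X i \<omega>)) = 1 / (2 * l * real n)"
    using n rate_pos by (simp add: field_simps power2_eq_square)
qed

lemma mean_approx_error:
  shows "integrable M (\<lambda>\<omega>. approx_error l k n (\<lambda>i. X i \<omega>))"
    and "0 < n \<Longrightarrow> expectation (\<lambda>\<omega>. approx_error l k n (\<lambda>i. X i \<omega>))
      = (real k)\<^sup>2 / (real n - real k) * (1 / l) + (real k)\<^sup>2 * (1 / (2 * l * real n))"
  using sample_mean_X mean_survival_distance by (simp_all add: approx_error_def)

text \<open>
  The second moment is expanded into products of \<open>exp_primitive\<close>; the mixed term has total rate
  \<open>2 * s * l\<close>, the pure terms have \<open>(2 * s + 1) * l\<close> and \<open>(2 * s - 1) * l\<close>, whose product is the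
  source of the denominator \<open>4 * s\<^sup>2 - 1\<close>.
\<close>

lemma influence_moments:
  assumes s: "1 \<le> s"
  shows "expectation (\<lambda>\<omega>. influence l s (X i \<omega>)) = 0"
    and "integrable M (\<lambda>\<omega>. (influence l s (X i \<omega>))\<^sup>2)"
    and "expectation (\<lambda>\<omega>. (influence l s (X i \<omega>))\<^sup>2) = (real s / (4 * (real s)\<^sup>2 - 1)) / l\<^sup>2"
proof -
  define a b where "a = real s * l" and "b = (real s - 1) * l"
  have ab: "0 \<le> a" "0 \<le> b"
    using s rate_pos by (auto simp: a_def b_def)
  note first = exponential_mean_exp_primitive[OF rate_pos exponential[of i]]
  note second = exponential_mean_exp_primitive_mult[OF rate_pos exponential[of i]]
  have sums: "a + l = (real s + 1) * l" "b + l = real s * l" "a + a + l = (2 * real s + 1) * l"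
    "b + b + l = (2 * real s - 1) * l" "a + b + l = 2 * real s * l"
    by (simp_all add: a_def b_def algebra_simps)
  have pos: "real s > 0" "real s + 1 > 0" "2 * real s + 1 > 0" "2 * real s - 1 > 0"
    using s by auto
  have "expectation (\<lambda>\<omega>. influence l s (X i \<omega>))
    = (real s + 1)\<^sup>2 * (1 / (a + l)) - (real s)\<^sup>2 * (1 / (b + l)) - 1 / l"
    using first[OF ab(1)] first[OF ab(2)]
    unfolding influence_def a_def[symmetric] b_def[symmetric] by (simp add: prob_space)
  also have "\<dots> = 0"
    unfolding sums using pos rate_pos
    by (simp add: divide_simps) (simp add: algebra_simps power2_eq_square)
  finally show "expectation (\<lambda>\<omega>. influence l s (X i \<omega>)) = 0" .
  let ?U = "\<lambda>\<omega>. exp_primitive a (X i \<omega>)" and ?V = "\<lambda>\<omega>. exp_primitive b (X i \<omega>)"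
  have expand: "(influence l s (X i \<omega>))\<^sup>2
    = (real s + 1)^4 * (?U \<omega> * ?U \<omega>) + (real s)^4 * (?V \<omega> * ?V \<omega>)
      - 2 * (real s + 1)\<^sup>2 * (real s)\<^sup>2 * (?U \<omega> * ?V \<omega>)
      - 2 * (real s + 1)\<^sup>2 / l * ?U \<omega> + 2 * (real s)\<^sup>2 / l * ?V \<omega> + 1 / l\<^sup>2" for \<omega>
    unfolding influence_def a_def[symmetric] b_def[symmetric]
    by (simp add: power2_eq_square power4_eq_xxxx algebra_simps add_divide_distrib diff_divide_distrib)
  note int = first(1)[OF ab(1)] first(1)[OF ab(2)] second(1)[OF ab(1) ab(1)]
    second(1)[OF ab(2) ab(2)] second(1)[OF ab(1) ab(2)]
  show "integrable M (\<lambda>\<omega>. (influence l s (X i \<omega>))\<^sup>2)"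
    unfolding expand using int
    by (intro Bochner_Integration.integrable_add Bochner_Integration.integrable_diff
        integrable_mult_right) auto
  have "expectation (\<lambda>\<omega>. (influence l s (X i \<omega>))\<^sup>2)
    = (real s + 1)^4 * ((1 / (a + l) + 1 / (a + l)) / (a + a + l))
      + (real s)^4 * ((1 / (b + l) + 1 / (b + l)) / (b + b + l))
      - 2 * (real s + 1)\<^sup>2 * (real s)\<^sup>2 * ((1 / (a + l) + 1 / (b + l)) / (a + b + l))
      - 2 * (real s + 1)\<^sup>2 / l * (1 / (a + l)) + 2 * (real s)\<^sup>2 / l * (1 / (b + l)) + 1 / l\<^sup>2"
    unfolding expand using int first(2)[OF ab(1)] first(2)[OF ab(2)] second(2)[OF ab(1) ab(1)]
      second(2)[OF ab(2) ab(2)] second(2)[OF ab(1) ab(2)]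
    by (simp add: prob_space mult.commute[of _ l])
  also have "\<dots> = (2 * (real s + 1)^3 / (2 * real s + 1) + 2 * (real s)^3 / (2 * real s - 1)
      - (real s + 1) * (2 * real s + 1) - 2 * (real s + 1) + 2 * real s + 1) / l\<^sup>2"
    unfolding sums using pos rate_pos
    by (simp add: divide_simps) (simp add: algebra_simps power2_eq_square power3_eq_cube power4_eq_xxxx)
  also have "2 * (real s + 1)^3 / (2 * real s + 1) + 2 * (real s)^3 / (2 * real s - 1)
      - (real s + 1) * (2 * real s + 1) - 2 * (real s + 1) + 2 * real s + 1
    = real s / ((2 * real s + 1) * (2 * real s - 1))"
    using pos by (simp add: divide_simps) (simp add: algebra_simps power2_eq_square power3_eq_cube)
  also have "(2 * real s + 1) * (2 * real s - 1) = 4 * (real s)\<^sup>2 - 1"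
    by (simp add: algebra_simps power2_eq_square)
  finally show "expectation (\<lambda>\<omega>. (influence l s (X i \<omega>))\<^sup>2)
    = (real s / (4 * (real s)\<^sup>2 - 1)) / l\<^sup>2" .
qed

lemma second_moment_sample_mean:
  fixes g :: "real \<Rightarrow> real"
  assumes g: "g \<in> borel_measurable borel"
    and "\<And>i. expectation (\<lambda>\<omega>. g (X i \<omega>)) = 0"
    and "\<And>i. integrable M (\<lambda>\<omega>. (g (X i \<omega>))\<^sup>2)"
    and "\<And>i. expectation (\<lambda>\<omega>. (g (X i \<omega>))\<^sup>2) = v"
  shows "integrable M (\<lambda>\<omega>. (sample_mean n (\<lambda>i. g (X i \<omega>)))\<^sup>2)"
    and "expectation (\<lambda>\<omega>. (sample_mean n (\<lambda>i. g (X i \<omega>)))\<^sup>2) = v / real n"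
  using second_moment_indep_sum[OF finite_lessThan indep_transform[OF g], of n] assms
  by (simp_all add: sample_mean_def power_divide power2_eq_square)

lemma centered_sample_mean:
  shows "integrable M (\<lambda>\<omega>. (sample_mean n (\<lambda>i. X i \<omega>) - 1 / l)\<^sup>2)"
    and "0 < n \<Longrightarrow> expectation (\<lambda>\<omega>. (sample_mean n (\<lambda>i. X i \<omega>) - 1 / l)\<^sup>2) = 1 / (l\<^sup>2 * real n)"
proof -
  note first = exponential_mean_exp_primitive[OF rate_pos exponential, of 0, simplified]
  note second = exponential_mean_exp_primitive_mult[OF rate_pos exponential, of 0 0, simplified]
  have expand: "(x - 1 / l)\<^sup>2 = x * x - 2 / l * x + 1 / l\<^sup>2" for x
    by (simp add: power2_eq_square algebra_simps add_divide_distrib diff_divide_distrib)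
  have mean: "expectation (\<lambda>\<omega>. X i \<omega> - 1 / l) = 0" for i
    using first by (simp add: prob_space)
  have int: "integrable M (\<lambda>\<omega>. (X i \<omega> - 1 / l)\<^sup>2)" for i
    unfolding expand using first second by simp
  have var: "expectation (\<lambda>\<omega>. (X i \<omega> - 1 / l)\<^sup>2) = 1 / l\<^sup>2" for i
    unfolding expand using first second by (simp add: prob_space power2_eq_square)
  note * = second_moment_sample_mean[of "\<lambda>x. x - 1 / l", OF _ mean int var]
  have centre: "sample_mean n (\<lambda>i. X i \<omega> - 1 / l) = sample_mean n (\<lambda>i. X i \<omega>) - 1 / l" if "0 < n" for \<omega>
    using that by (simp add: sample_mean_def sum_subtractf diff_divide_distrib)
  show "integrable M (\<lambda>\<omega>. (sample_mean n (\<lambda>i. X i \<omega>) - 1 / l)\<^sup>2)"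
  proof (cases "n = 0")
    case False
    then show ?thesis using *(1)[of n] centre by simp
  qed (simp add: sample_mean_def)
  show "expectation (\<lambda>\<omega>. (sample_mean n (\<lambda>i. X i \<omega>) - 1 / l)\<^sup>2) = 1 / (l\<^sup>2 * real n)" if "0 < n"
    using *(2)[of n] centre[OF that] by simp
qed

lemma asymptotic_variance_pos:
  assumes "1 \<le> s"
  shows "0 < real s / (4 * (real s)\<^sup>2 - 1)"
proof -
  have "1 \<le> (real s)\<^sup>2"
    using assms by (intro one_le_power) simp
  then have "0 < 4 * (real s)\<^sup>2 - 1"
    by linarith
  then show ?thesis
    using assms by simp
qed

lemma influence_CLT:
  assumes s: "1 \<le> s"
  defines "\<sigma> \<equiv> sqrt (real s / (4 * (real s)\<^sup>2 - 1))"
  shows "weak_conv_m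
    (\<lambda>n. distr M borel (\<lambda>\<omega>. l * (sqrt (real n) * sample_mean n (\<lambda>i. influence l s (X i \<omega>)))))
    (density lborel (normal_density 0 \<sigma>))"
proof -
  from asymptotic_variance_pos[OF s] have \<sigma>: "0 < \<sigma>" "\<sigma>\<^sup>2 = real s / (4 * (real s)\<^sup>2 - 1)"
    by (simp_all add: \<sigma>_def)
  define \<mu> where "\<mu> = distr (density lborel (exponential_density l)) borel (influence l s)"
  have "weak_conv_m (\<lambda>n. distr M borel (\<lambda>\<omega>. (\<Sum>i<n. influence l s (X i \<omega>)) / sqrt (real n * (\<sigma> / l)\<^sup>2)))
      std_normal_distribution"
  proof (rule central_limit_theorem_zero_mean)
    show "indep_vars (\<lambda>i. borel) (\<lambda>i \<omega>. influence l s (X i \<omega>)) UNIV"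
      by (rule indep_transform) simp
    show "0 < \<sigma> / l"
      using \<sigma> rate_pos by simp
    fix n
    show "expectation (\<lambda>\<omega>. influence l s (X n \<omega>)) = 0"
      and "integrable M (\<lambda>\<omega>. (influence l s (X n \<omega>))\<^sup>2)"
      using influence_moments[OF s] by auto
    show "variance (\<lambda>\<omega>. influence l s (X n \<omega>)) = (\<sigma> / l)\<^sup>2"
      using influence_moments[OF s] \<sigma> by (simp add: power_divide)
    have "distr M borel (\<lambda>\<omega>. influence l s (X n \<omega>)) = distr (distr M lborel (X n)) borel (influence l s)"
      by (subst distr_distr) (auto simp: comp_def)
    then show "distr M borel (\<lambda>\<omega>. influence l s (X n \<omega>)) = \<mu>"
      by (simp add: \<mu>_def distributed_distr_eq_density[OF exponential])
  qed
  then have "weak_conv_m (\<lambda>n. distr M borel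
      (\<lambda>\<omega>. \<sigma> * ((\<Sum>i<n. influence l s (X i \<omega>)) / sqrt (real n * (\<sigma> / l)\<^sup>2))))
      (density lborel (normal_density 0 \<sigma>))"
    using \<sigma>(1) by (intro weak_conv_m_scale_normal) auto
  moreover have "\<sigma> * (S / sqrt (real n * (\<sigma> / l)\<^sup>2)) = l * (sqrt (real n) * (S / real n))" for n S
  proof (cases "n = 0")
    case False
    then have "sqrt (real n) * (S / real n) = S / sqrt (real n)"
      by (simp add: field_simps)
    then show ?thesis
      using \<sigma>(1) rate_pos by (simp add: real_sqrt_mult)
  qed simp
  ultimately show ?thesis
    by (simp add: sample_mean_def)
qed

text \<open>
  Both parts of the error have mean of order \<open>1 / n\<close>.
\<close>

lemma sqrt_mult_mean_approx_error:
  "(\<lambda>n. sqrt (real n) * expectation (\<lambda>\<omega>. approx_error l k n (\<lambda>i. X i \<omega>))) \<longlonglongrightarrow> 0"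
proof -
  define c where "c = (real k)\<^sup>2"
  have "(\<lambda>n. sqrt (real n) * (1 / (real n - real k))) \<longlonglongrightarrow> 0"
    "(\<lambda>n. sqrt (real n) * (1 / real n)) \<longlonglongrightarrow> 0"
    by real_asymp+
  then have "(\<lambda>n. c / l * (sqrt (real n) * (1 / (real n - real k)))
      + c / (2 * l) * (sqrt (real n) * (1 / real n))) \<longlonglongrightarrow> c / l * 0 + c / (2 * l) * 0"
    by (intro tendsto_intros)
  moreover have "\<forall>\<^sub>F n in sequentially. c / l * (sqrt (real n) * (1 / (real n - real k)))
      + c / (2 * l) * (sqrt (real n) * (1 / real n))
      = sqrt (real n) * expectation (\<lambda>\<omega>. approx_error l k n (\<lambda>i. X i \<omega>))"
    using eventually_gt_at_top[of 0]
    by eventually_elim (simp add: mean_approx_error(2) c_def distrib_left ac_simps)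
  ultimately show ?thesis
    using tendsto_cong by fastforce
qed

lemma Delta_hat_star_weak_conv:
  assumes s: "1 \<le> s"
  defines "\<sigma> \<equiv> sqrt (real s / (4 * (real s)\<^sup>2 - 1))"
  shows "weak_conv_m
    (\<lambda>n. distr M borel (\<lambda>\<omega>. sqrt (real n) * Delta_hat_star s n (\<lambda>i. X i \<omega>)))
    (density lborel (normal_density 0 \<sigma>))"
proof -
  from asymptotic_variance_pos[OF s] have \<sigma>: "0 < \<sigma>"
    by (simp_all add: \<sigma>_def)
  define m where "m n \<omega> = sample_mean n (\<lambda>i. X i \<omega>)" for n \<omega>
  define Y where "Y n \<omega> = sample_mean n (\<lambda>i. influence l s (X i \<omega>))" for n \<omega>
  define e where "e k n \<omega> = approx_error l k n (\<lambda>i. X i \<omega>)" for k n \<omega>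
  define v where "v = (real s / (4 * (real s)\<^sup>2 - 1)) / l\<^sup>2"
  define R where "R n \<omega> = sqrt (real n) * ((real s + 1) * e (s + 1) n \<omega> + real s * e s n \<omega>)" for n \<omega>
  \<comment> \<open>The bound of \<open>ratio_approx\<close> with \<open>Z = sqrt n * Y n\<close> and weight \<open>e = sqrt n\<close>.\<close>
  define W where "W n \<omega> = 2 * l * R n \<omega>
    + l\<^sup>2 * ((sqrt (real n) * Y n \<omega>)\<^sup>2 / sqrt (real n) + sqrt (real n) * (m n \<omega> - 1 / l)\<^sup>2)
    + 4 * l\<^sup>2 * (m n \<omega> - 1 / l)\<^sup>2" for n \<omega>
  have e: "integrable M (e k n)" for k n
    using mean_approx_error(1)[of k n] by (simp add: e_def[abs_def])
  have Y: "integrable M (\<lambda>\<omega>. (Y n \<omega>)\<^sup>2)" "expectation (\<lambda>\<omega>. (Y n \<omega>)\<^sup>2) = v / real n" for n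
    using second_moment_sample_mean[of "influence l s" v n] influence_moments[OF s]
    by (simp_all add: Y_def v_def)
  have m: "integrable M (\<lambda>\<omega>. (m n \<omega> - 1 / l)\<^sup>2)"
    "0 < n \<Longrightarrow> expectation (\<lambda>\<omega>. (m n \<omega> - 1 / l)\<^sup>2) = 1 / (l\<^sup>2 * real n)" for n
    using centered_sample_mean by (simp_all add: m_def)
  have W: "integrable M (W n)" for n
    using e Y m by (simp add: W_def[abs_def] R_def power_mult_distrib)
  have EW: "expectation (W n) = 2 * l * ((real s + 1) * (sqrt (real n) * expectation (e (s + 1) n))
      + real s * (sqrt (real n) * expectation (e s n)))
      + l\<^sup>2 * (v * (1 / sqrt (real n)) + 1 / l\<^sup>2 * (1 / sqrt (real n))) + 4 * (1 / real n)" if "0 < n" for n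
  proof -
    have "expectation (W n) = 2 * l * (sqrt (real n) * ((real s + 1) * expectation (e (s + 1) n)
        + real s * expectation (e s n)))
      + l\<^sup>2 * (real n * (v / real n) / sqrt (real n) + sqrt (real n) * (1 / (l\<^sup>2 * real n)))
      + 4 * l\<^sup>2 * (1 / (l\<^sup>2 * real n))"
      using e Y m that by (simp add: W_def[abs_def] R_def power_mult_distrib)
    also have "sqrt (real n) * (1 / (l\<^sup>2 * real n)) = 1 / l\<^sup>2 * (1 / sqrt (real n))"
      using that rate_pos by (simp add: field_simps)
    finally show ?thesis
      using that rate_pos by (simp add: algebra_simps)
  qed
  have "(\<lambda>n. 1 / sqrt (real n)) \<longlonglongrightarrow> 0" "(\<lambda>n. 1 / real n) \<longlonglongrightarrow> 0"
    by real_asymp+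
  moreover have "(\<lambda>n. sqrt (real n) * expectation (e k n)) \<longlonglongrightarrow> 0" for k
    using sqrt_mult_mean_approx_error[of k] by (simp add: e_def[abs_def])
  ultimately have "(\<lambda>n. 2 * l * ((real s + 1) * (sqrt (real n) * expectation (e (s + 1) n))
      + real s * (sqrt (real n) * expectation (e s n)))
      + l\<^sup>2 * (v * (1 / sqrt (real n)) + 1 / l\<^sup>2 * (1 / sqrt (real n))) + 4 * (1 / real n))
    \<longlonglongrightarrow> 2 * l * ((real s + 1) * 0 + real s * 0) + l\<^sup>2 * (v * 0 + 1 / l\<^sup>2 * 0) + 4 * 0"
    by (intro tendsto_add tendsto_mult tendsto_const)
  then have "(\<lambda>n. 2 * l * ((real s + 1) * (sqrt (real n) * expectation (e (s + 1) n))
      + real s * (sqrt (real n) * expectation (e s n)))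
      + l\<^sup>2 * (v * (1 / sqrt (real n)) + 1 / l\<^sup>2 * (1 / sqrt (real n))) + 4 * (1 / real n)) \<longlonglongrightarrow> 0"
    by simp
  moreover have "\<forall>\<^sub>F n in sequentially. 2 * l * ((real s + 1) * (sqrt (real n) * expectation (e (s + 1) n))
      + real s * (sqrt (real n) * expectation (e s n)))
      + l\<^sup>2 * (v * (1 / sqrt (real n)) + 1 / l\<^sup>2 * (1 / sqrt (real n))) + 4 * (1 / real n)
      = expectation (W n)"
    using eventually_gt_at_top[of 0] by eventually_elim (rule EW[symmetric])
  ultimately have lim: "(\<lambda>n. expectation (W n)) \<longlonglongrightarrow> 0"
    by (rule Lim_transform_eventually)
  have close: "AE \<omega> in M. min 1 \<bar>sqrt (real n) * Delta_hat_star s n (\<lambda>i. X i \<omega>) - l * (sqrt (real n) * Y n \<omega>)\<bar> \<le> W n \<omega>"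
    if n: "s + 1 < n" for n
    using AE_nonneg
  proof eventually_elim
    case (elim \<omega>)
    have "\<bar>Delta_hat s n (\<lambda>i. X i \<omega>) - Y n \<omega>\<bar> \<le> (real s + 1) * e (s + 1) n \<omega> + real s * e s n \<omega>"
      unfolding Y_def e_def using elim by (intro Delta_hat_approx rate_pos s n) auto
    then have "sqrt (real n) * \<bar>Delta_hat s n (\<lambda>i. X i \<omega>) - Y n \<omega>\<bar> \<le> R n \<omega>"
      unfolding R_def by (intro mult_left_mono) auto
    then have "\<bar>sqrt (real n) * Delta_hat s n (\<lambda>i. X i \<omega>) - sqrt (real n) * Y n \<omega>\<bar> \<le> R n \<omega>"
      by (simp add: right_diff_distrib[symmetric] abs_mult)
    from ratio_approx[OF rate_pos this, of "sqrt (real n)" "m n \<omega>"] n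
    show ?case
      by (simp add: W_def m_def Delta_hat_star_def)
  qed
  show ?thesis
  proof (rule weak_conv_m_of_close)
    show "(\<lambda>\<omega>. sqrt (real n) * Delta_hat_star s n (\<lambda>i. X i \<omega>)) \<in> borel_measurable M" for n
      by (intro borel_measurable_times borel_measurable_const borel_measurable_Delta_hat_star X_measurable)
    show "(\<lambda>\<omega>. l * (sqrt (real n) * Y n \<omega>)) \<in> borel_measurable M" for n
      unfolding Y_def sample_mean_def by measurable
    show "real_distribution (density lborel (normal_density 0 \<sigma>))"
      using \<sigma> by (intro real_distribution.intro real_distribution_axioms.intro prob_space_normal_density) auto
    show "weak_conv_m (\<lambda>n. distr M borel (\<lambda>\<omega>. l * (sqrt (real n) * Y n \<omega>))) (density lborel (normal_density 0 \<sigma>))"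
      using influence_CLT[OF s] by (simp add: Y_def \<sigma>_def)
    show "\<forall>\<^sub>F n in sequentially. AE \<omega> in M.
        min 1 \<bar>sqrt (real n) * Delta_hat_star s n (\<lambda>i. X i \<omega>) - l * (sqrt (real n) * Y n \<omega>)\<bar> \<le> W n \<omega>"
      using eventually_gt_at_top[of "s + 1"] by eventually_elim (rule close)
  qed (use W lim in auto)
qed

end

theorem corollary5:
  fixes M :: "'a measure" and X :: "nat \<Rightarrow> 'a \<Rightarrow> real" and l :: real and s :: nat
  assumes "prob_space M"
    and "s \<ge> 1"
    and "l > 0"
    and "prob_space.indep_vars M (\<lambda>_. borel) X UNIV"
    and "\<And>i. distributed M lborel (X i) (exponential_density l)"
  shows "weak_conv_m
    (\<lambda>n. distr M borel (\<lambda>\<omega>. sqrt (real n) * Delta_hat_star s n (\<lambda>i. X i \<omega>)))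
    (density lborel (normal_density 0 (sqrt (real s / (4 * (real s)\<^sup>2 - 1)))))"
proof -
  interpret exponential_sample M X l
    using assms by (intro exponential_sample.intro exponential_sample_axioms.intro)
  show ?thesis
    using assms(2) by (rule Delta_hat_star_weak_conv)
qed

end
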